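(* Let $G$ be a finite group and let $\varphi : \Gamma \to \Gamma'$ be a $G$-Galois covering between tropical curves. Then, for any finite harmonic morphism $\psi : \Gamma \to \Gamma''$ to a tropical curve $\Gamma''$ satisfying $\psi \circ g = \psi$ for any $g \in G$, there exists a unique finite harmonic morphism $\theta : \Gamma' \to \Gamma''$ satisfying $\psi = \theta \circ \varphi$.
   Context: Graphs are unweighted, undirected, finite, connected, nonempty multigraphs that may have loops. A leaf end is a vertex of degree one (a loop counts twice), and a leaf edge is an edge incident to a leaf end. A tropical curve $\Gamma$ is the underlying topological space of a pair $(\mathcal{G}, l)$, where $\mathcal{G}$ is a graph and $l : E(\mathcal{G}) \to \mathbf{R}_{>0} \cup \{\infty\}$ is a length function taking the value $\infty$ only on leaf edges, together with an identification of each edge $e$ with the closed interval $[0, l(e)]$; when $l(e) = \infty$, $[0,\infty]$ is the one-point compactification of $[0,\infty)$ and the leaf end of $e$ must be identified with $\infty$ (if $e$ is the only edge, either leaf end may be identified with $\infty$). The distance between $\infty$ and any other point is infinite. Such a pair $(\mathcal{G}, l)$ is called a model for $\Gamma$ (a given $\Gamma$ has many models); it is loopless if $\mathcal{G}$ is loopless. $\Gamma_\infty$ denotes the set of points identified with $\infty$. Vertices and edges are identified with the corresponding points and closed subsets of $\Gamma$. A continuous map $\varphi : \Gamma \to \Gamma'$ between tropical curves is a finite morphism if there exist loopless models $(\mathcal{G}, l)$ and $(\mathcal{G}', l')$ for $\Gamma$ and $\Gamma'$ such that $\varphi(V(\mathcal{G})) \subset V(\mathcal{G}')$, $\varphi(E(\mathcal{G}))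 \subset E(\mathcal{G}')$, and for any edge $e$ of $\mathcal{G}$ there is a positive integer $\deg_e(\varphi)$ with $\operatorname{dist}(\varphi(x), \varphi(y)) = \deg_e(\varphi) \cdot \operatorname{dist}(x,y)$ for all $x, y \in e$. A finite morphism $\varphi$ is harmonic if for every vertex $v$ of $\mathcal{G}$ the sum $\sum_{e \in E(\mathcal{G}):\, e \mapsto e',\, v \in e} \deg_e(\varphi)$ is independent of the choice of $e' \in E(\mathcal{G}')$ incident to $\varphi(v)$; this sum is denoted $\deg_v(\varphi)$. Then $\sum_{v \in V(\mathcal{G}):\, v \mapsto v'} \deg_v(\varphi)$ is independent of the vertex $v'$ of $\mathcal{G}'$ and is called the degree $\deg(\varphi)$. If both $\Gamma$ and $\Gamma'$ are singletons, $\varphi$ is regarded as a finite harmonic morphism that can have any number as its degree. A finite group $G$ acts isometrically on $\Gamma$ if $G$ acts continuously on $\Gamma$ and the action is isometric on $\Gamma \setminus \Gamma_\infty$. For an isometric action of a finite group $G$ on $\Gamma$, a map $\varphi : \Gamma \to \Gamma'$ between tropical curves is $G$-Galois (a $G$-Galois covering) if (1) $\varphi$ is a finite harmonic morphism, (2) the order of $G$ coincides with the degree of $\varphi$, (3) the action of $G$ on $\Gamma$ induces a transitive action on every fiber of $\varphi$, and (4) the stabilizer subgroup of $G$ is trivial at all but finitely many points of $\Gamma$. *)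

theory Defs
  imports "HOL-Analysis.Analysis" "HOL-Algebra.Group_Action" "HOL-Library.Multiset"
begin

section \<open>Finite multigraphs\<close>

text \<open>An edge has a multiset of two endpoints; a loop at \<open>v\<close> has endpoints \<open>{#v, v#}\<close> and hence
  counts twice in the valency of \<open>v\<close>.\<close>

record ('v, 'e) multigraph =
  verts :: "'v set"
  edges :: "'e set"
  ends :: "'e \<Rightarrow> 'v multiset"

definition multigraph :: "('v, 'e, 'z) multigraph_scheme \<Rightarrow> bool" where
  "multigraph \<G> \<longleftrightarrow>
     finite (verts \<G>) \<and> finite (edges \<G>) \<and> verts \<G> \<noteq> {} \<and>
     (\<forall>e\<in>edges \<G>. size (ends \<G> e) = 2 \<and> set_mset (ends \<G> e) \<subseteq> verts \<G>) \<and>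
     (\<forall>u\<in>verts \<G>. \<forall>v\<in>verts \<G>. (u, v) \<in> {(a, b). \<exists>e\<in>edges \<G>. ends \<G> e = {#a, b#}}\<^sup>*)"

definition loopless :: "('v, 'e, 'z) multigraph_scheme \<Rightarrow> bool" where
  "loopless \<G> \<longleftrightarrow> (\<forall>e\<in>edges \<G>. \<forall>v. ends \<G> e \<noteq> {#v, v#})"

definition valency :: "('v, 'e, 'z) multigraph_scheme \<Rightarrow> 'v \<Rightarrow> nat" where
  "valency \<G> v = (\<Sum>e\<in>edges \<G>. count (ends \<G> e) v)"

definition leaf_end :: "('v, 'e, 'z) multigraph_scheme \<Rightarrow> 'v \<Rightarrow> bool" where
  "leaf_end \<G> v \<longleftrightarrow> v \<in> verts \<G> \<and> valency \<G> v = 1"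

definition leaf_edge :: "('v, 'e, 'z) multigraph_scheme \<Rightarrow> 'e \<Rightarrow> bool" where
  "leaf_edge \<G> e \<longleftrightarrow> e \<in> edges \<G> \<and> (\<exists>v. v \<in># ends \<G> e \<and> leaf_end \<G> v)"


section \<open>Tropical curves and their models\<close>

text \<open>The topology is recorded separately because it is not the one induced by the distance: a point at
  infinity is isolated for the distance but not for the topology.\<close>

record 'a tcurve =
  tc_top :: "'a topology"
  tc_dist :: "'a \<Rightarrow> 'a \<Rightarrow> ereal"

abbreviation points :: "('a, 'z) tcurve_scheme \<Rightarrow> 'a set" where
  "points \<Gamma> \<equiv> topspace (tc_top \<Gamma>)"

text \<open>In a model of \<open>\<Gamma>\<close>, vertices are points and edges are subsets of \<open>\<Gamma>\<close>; distinct edges of a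
  multigraph give distinct subsets, so nothing is lost. The identification of an edge \<open>e\<close> with
  \<open>[0, len e]\<close> is \<open>chart e\<close>, defined on \<open>{0..len e}\<close>; for a loop it takes the same value at
  both ends.\<close>

record 'a tmodel =
  graph :: "('a, 'a set) multigraph"
  len :: "'a set \<Rightarrow> ereal"
  chart :: "'a set \<Rightarrow> ereal \<Rightarrow> 'a"

abbreviation mV :: "('a, 'z) tmodel_scheme \<Rightarrow> 'a set" where
  "mV M \<equiv> verts (graph M)"

abbreviation mE :: "('a, 'z) tmodel_scheme \<Rightarrow> 'a set set" where
  "mE M \<equiv> edges (graph M)"

definition edge_interior :: "('a, 'z) tmodel_scheme \<Rightarrow> 'a set \<Rightarrow> 'a set" where
  "edge_interior M e = chart M e ` {0<..<len M e}"

text \<open>\<open>path_length M x y r\<close>: some concatenation of finitely many segments, each inside an edge, leads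
  from \<open>x\<close> to \<open>y\<close> and has total length \<open>r\<close>. On \<open>ereal\<close> we have \<open>\<bar>\<infinity> - t\<bar> = \<infinity>\<close> for all \<open>t\<close>, so
  every nonempty path from or to a point at infinity has length \<open>\<infinity>\<close>; the empty path
  gives distance \<open>0\<close> from such a point to itself.\<close>

inductive path_length :: "('a, 'z) tmodel_scheme \<Rightarrow> 'a \<Rightarrow> 'a \<Rightarrow> ereal \<Rightarrow> bool"
  for M :: "('a, 'z) tmodel_scheme" where
  empty: "path_length M x x 0"
| segment: "\<lbrakk>path_length M x (chart M e s) r; e \<in> mE M; s \<in> {0..len M e}; t \<in> {0..len M e}\<rbrakk>
    \<Longrightarrow> path_length M x (chart M e t) (r + \<bar>s - t\<bar>)"

text \<open>\<open>is_model \<Gamma> M\<close>: up to the identifications of \<open>M\<close>, the curve \<open>\<Gamma>\<close> is the disjoint union of the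
  vertices and the intervals \<open>[0, len e]\<close>, glued at the endpoints, with the quotient topology and
  the path distance. The subspace topology of \<open>{0..\<infinity>}\<close> in \<open>ereal\<close> is the one-point
  compactification of \<open>[0, \<infinity>)\<close>.\<close>

definition is_model :: "('a, 'y) tcurve_scheme \<Rightarrow> ('a, 'z) tmodel_scheme \<Rightarrow> bool" where
  "is_model \<Gamma> M \<longleftrightarrow>
     multigraph (graph M) \<and>
     (\<forall>e\<in>mE M. 0 < len M e) \<and>
     (\<forall>e\<in>mE M. len M e = \<infinity> \<longrightarrow> leaf_edge (graph M) e \<and> leaf_end (graph M) (chart M e \<infinity>)) \<and>
     (\<forall>e\<in>mE M. ends (graph M) e = {#chart M e 0, chart M e (len M e)#}) \<and>
     (\<forall>e\<in>mE M. chart M e ` {0..len M e} = e) \<and>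
     (\<forall>e\<in>mE M. inj_on (chart M e) {0<..<len M e}) \<and>
     (\<forall>e\<in>mE M. edge_interior M e \<inter> mV M = {}) \<and>
     (\<forall>e\<in>mE M. \<forall>f\<in>mE M. e \<noteq> f \<longrightarrow> edge_interior M e \<inter> edge_interior M f = {}) \<and>
     points \<Gamma> = mV M \<union> \<Union> (mE M) \<and>
     (\<forall>U. U \<subseteq> points \<Gamma> \<longrightarrow>
        (openin (tc_top \<Gamma>) U \<longleftrightarrow>
          (\<forall>e\<in>mE M. openin (top_of_set {0..len M e}) {t \<in> {0..len M e}. chart M e t \<in> U}))) \<and>
     (\<forall>x\<in>points \<Gamma>. \<forall>y\<in>points \<Gamma>. tc_dist \<Gamma> x y = Inf {r. path_length M x y r})"

definition tropical_curve :: "('a, 'y) tcurve_scheme \<Rightarrow> bool" where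
  "tropical_curve \<Gamma> \<longleftrightarrow> (\<exists>M :: 'a tmodel. is_model \<Gamma> M)"

definition points_at_infinity :: "('a, 'y) tcurve_scheme \<Rightarrow> 'a set" where
  "points_at_infinity \<Gamma> =
     {x. \<exists>M :: 'a tmodel. is_model \<Gamma> M \<and> (\<exists>e\<in>mE M. len M e = \<infinity> \<and> x = chart M e \<infinity>)}"


section \<open>Finite harmonic morphisms\<close>

text \<open>The predicates with suffix \<open>_wrt\<close> refer to chosen models \<open>M\<close>, \<open>M'\<close> and to the family \<open>d\<close> of
  degrees of the edges of \<open>M\<close>.\<close>

definition finite_morphism_wrt ::
  "'a tcurve \<Rightarrow> 'b tcurve \<Rightarrow> 'a tmodel \<Rightarrow> 'b tmodel \<Rightarrow> ('a set \<Rightarrow> nat) \<Rightarrow> ('a \<Rightarrow> 'b) \<Rightarrow> bool" where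
  "finite_morphism_wrt \<Gamma> \<Gamma>' M M' d \<phi> \<longleftrightarrow>
     is_model \<Gamma> M \<and> is_model \<Gamma>' M' \<and> loopless (graph M) \<and> loopless (graph M') \<and>
     \<phi> ` mV M \<subseteq> mV M' \<and>
     (\<forall>e\<in>mE M. \<phi> ` e \<in> mE M') \<and>
     (\<forall>e\<in>mE M. 0 < d e \<and>
        (\<forall>x\<in>e. \<forall>y\<in>e. tc_dist \<Gamma>' (\<phi> x) (\<phi> y) = ereal (real (d e)) * tc_dist \<Gamma> x y))"

definition local_degree ::
  "'a tmodel \<Rightarrow> ('a set \<Rightarrow> nat) \<Rightarrow> ('a \<Rightarrow> 'b) \<Rightarrow> 'a \<Rightarrow> 'b set \<Rightarrow> nat" where
  "local_degree M d \<phi> v e' = (\<Sum>e\<in>{e \<in> mE M. \<phi> ` e = e' \<and> v \<in> e}. d e)"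

definition harmonic_wrt ::
  "'a tmodel \<Rightarrow> 'b tmodel \<Rightarrow> ('a set \<Rightarrow> nat) \<Rightarrow> ('a \<Rightarrow> 'b) \<Rightarrow> bool" where
  "harmonic_wrt M M' d \<phi> \<longleftrightarrow>
     (\<forall>v\<in>mV M. \<forall>e'\<in>mE M'. \<forall>f'\<in>mE M'.
        \<phi> v \<in># ends (graph M') e' \<longrightarrow> \<phi> v \<in># ends (graph M') f' \<longrightarrow>
        local_degree M d \<phi> v e' = local_degree M d \<phi> v f')"

text \<open>Well defined for a harmonic \<open>\<phi>\<close> as soon as \<open>M'\<close> has an edge.\<close>

definition vertex_degree ::
  "'a tmodel \<Rightarrow> 'b tmodel \<Rightarrow> ('a set \<Rightarrow> nat) \<Rightarrow> ('a \<Rightarrow> 'b) \<Rightarrow> 'a \<Rightarrow> nat" where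
  "vertex_degree M M' d \<phi> v =
     (THE n. \<forall>e'\<in>mE M'. \<phi> v \<in># ends (graph M') e' \<longrightarrow> local_degree M d \<phi> v e' = n)"

definition finite_morphism :: "'a tcurve \<Rightarrow> 'b tcurve \<Rightarrow> ('a \<Rightarrow> 'b) \<Rightarrow> bool" where
  "finite_morphism \<Gamma> \<Gamma>' \<phi> \<longleftrightarrow>
     tropical_curve \<Gamma> \<and> tropical_curve \<Gamma>' \<and> continuous_map (tc_top \<Gamma>) (tc_top \<Gamma>') \<phi> \<and>
     (\<exists>M M' d. finite_morphism_wrt \<Gamma> \<Gamma>' M M' d \<phi>)"

definition finite_harmonic_morphism :: "'a tcurve \<Rightarrow> 'b tcurve \<Rightarrow> ('a \<Rightarrow> 'b) \<Rightarrow> bool" where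
  "finite_harmonic_morphism \<Gamma> \<Gamma>' \<phi> \<longleftrightarrow>
     finite_morphism \<Gamma> \<Gamma>' \<phi> \<and>
     (\<exists>M M' d. finite_morphism_wrt \<Gamma> \<Gamma>' M M' d \<phi> \<and> harmonic_wrt M M' d \<phi>)"

text \<open>The degree is a relation and not a function because a morphism between singletons has every
  number as its degree. (Such a morphism is finite and harmonic by the definitions above.)\<close>

definition has_degree :: "'a tcurve \<Rightarrow> 'b tcurve \<Rightarrow> ('a \<Rightarrow> 'b) \<Rightarrow> nat \<Rightarrow> bool" where
  "has_degree \<Gamma> \<Gamma>' \<phi> n \<longleftrightarrow>
     finite_harmonic_morphism \<Gamma> \<Gamma>' \<phi> \<and>
     (is_singleton (points \<Gamma>) \<and> is_singleton (points \<Gamma>') \<or>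
      \<not> is_singleton (points \<Gamma>') \<and>
      (\<exists>M M' d. finite_morphism_wrt \<Gamma> \<Gamma>' M M' d \<phi> \<and> harmonic_wrt M M' d \<phi> \<and>
         (\<forall>v'\<in>mV M'. (\<Sum>v\<in>{v \<in> mV M. \<phi> v = v'}. vertex_degree M M' d \<phi> v) = n)))"


section \<open>Isometric actions and Galois coverings\<close>

definition isometric_action ::
  "('g, 'z) monoid_scheme \<Rightarrow> ('g \<Rightarrow> 'a \<Rightarrow> 'a) \<Rightarrow> 'a tcurve \<Rightarrow> bool" where
  "isometric_action G act \<Gamma> \<longleftrightarrow>
     group_action G (points \<Gamma>) act \<and>
     (\<forall>g\<in>carrier G. continuous_map (tc_top \<Gamma>) (tc_top \<Gamma>) (act g)) \<and>
     (\<forall>g\<in>carrier G. \<forall>x\<in>points \<Gamma> - points_at_infinity \<Gamma>. \<forall>y\<in>points \<Gamma> - points_at_infinity \<Gamma>.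
        tc_dist \<Gamma> (act g x) (act g y) = tc_dist \<Gamma> x y)"

definition fiber :: "'a tcurve \<Rightarrow> ('a \<Rightarrow> 'b) \<Rightarrow> 'b \<Rightarrow> 'a set" where
  "fiber \<Gamma> \<phi> x' = {x \<in> points \<Gamma>. \<phi> x = x'}"

definition galois_covering ::
  "('g, 'z) monoid_scheme \<Rightarrow> ('g \<Rightarrow> 'a \<Rightarrow> 'a) \<Rightarrow> 'a tcurve \<Rightarrow> 'b tcurve \<Rightarrow> ('a \<Rightarrow> 'b) \<Rightarrow> bool" where
  "galois_covering G act \<Gamma> \<Gamma>' \<phi> \<longleftrightarrow>
     finite_harmonic_morphism \<Gamma> \<Gamma>' \<phi> \<and>
     has_degree \<Gamma> \<Gamma>' \<phi> (order G) \<and>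
     (\<forall>x'\<in>points \<Gamma>'. transitive_action G (fiber \<Gamma> \<phi> x') (\<lambda>g. restrict (act g) (fiber \<Gamma> \<phi> x'))) \<and>
     finite {x \<in> points \<Gamma>. stabilizer G act x \<noteq> {\<one>\<^bsub>G\<^esub>}}"

end

theory Submission
  imports Defs
begin

text \<open>As \<open>\<psi>\<close> is constant on the orbits of \<open>G\<close>, which are the fibers of the surjective map \<open>\<phi>\<close>, there is
  exactly one map \<open>\<theta>\<close> with \<open>\<psi> = \<theta> \<circ> \<phi>\<close>. What has to be shown is that \<open>\<theta>\<close> is a finite harmonic
  morphism.

  The reason is that \<open>\<phi>\<close> has degree one on every edge (\<open>galois_covering_models\<close>). Over an interior point
  of an edge \<open>e'\<close>, the fiber has one point on each edge above \<open>e'\<close>. If the finitely many points with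
  nontrivial stabilizer are avoided, the fiber is a free orbit, so there are \<open>|G|\<close> edges above \<open>e'\<close>. But
  \<open>|G|\<close> is also the degree of \<open>\<phi>\<close>, which is the sum of the degrees of these edges
  (\<open>sum_vertex_degree\<close>); so each of them is one. Hence \<open>\<phi>\<close> is isometric on edges, and \<open>\<theta>\<close>
  stretches the edge \<open>\<phi>(e)\<close> by the same integer as \<open>\<psi>\<close> stretches \<open>e\<close>. The local degree of \<open>\<psi>\<close> at \<open>v\<close> is
  the product of those of \<open>\<theta>\<close> at \<open>\<phi>(v)\<close> and of \<open>\<phi>\<close> at \<open>v\<close> (\<open>local_degree_multiplicative\<close>). The latter
  is a positive integer, so \<open>\<theta>\<close> is harmonic because \<open>\<psi>\<close> is. Finally \<open>\<theta>\<close> is continuous because \<open>\<phi>\<close>,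
  being closed (\<open>closed_map\<close>), is a quotient map.

  This argument needs one model of \<open>\<Gamma>\<close> that serves both \<open>\<phi>\<close> and \<open>\<psi>\<close>. Any finite set of points can
  be added to the vertices of a model (\<open>exists_subdivision\<close>). Add to the vertices of \<open>\<Gamma>''\<close> the images
  under \<open>\<psi>\<close> of the vertices used for \<open>\<phi>\<close>, and let \<open>V\<close> be the preimage of the result. Since \<open>\<psi>\<close> is
  constant on the fibers of \<open>\<phi>\<close>, the set \<open>V\<close> is also the preimage of \<open>\<phi>(V)\<close>. Both morphisms can now
  be rewritten in terms of models whose vertices are \<open>V\<close> and its images
  (\<open>edge_onto_edge\<close>, \<open>local_degree_refined\<close>). This rests on two facts about a loopless model: the
  interiors of the edges are the connected components of the complement of the vertices
  (\<open>connectedin_off_vertices\<close>), so that the edges are determined by the vertices, and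
  different points have positive distance (\<open>tc_dist_pos\<close>), so that a finite morphism is injective on
  each edge.\<close>

section \<open>Edges and topology of a loopless model\<close>

locale loopless_model =
  fixes \<Gamma> :: "'a tcurve" and M :: "'a tmodel"
  assumes is_model: "is_model \<Gamma> M" and loopless: "loopless (graph M)"
begin

lemma
  shows finite_vertices: "finite (mV M)"
    and finite_edges: "finite (mE M)"
    and len_pos: "e \<in> mE M \<Longrightarrow> 0 < len M e"
    and ends_eq: "e \<in> mE M \<Longrightarrow> ends (graph M) e = {#chart M e 0, chart M e (len M e)#}"
    and ends_in_vertices: "e \<in> mE M \<Longrightarrow> set_mset (ends (graph M) e) \<subseteq> mV M"
    and chart_image: "e \<in> mE M \<Longrightarrow> chart M e ` {0..len M e} = e"
    and chart_inj_interior: "e \<in> mE M \<Longrightarrow> inj_on (chart M e) {0<..<len M e}"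
    and edge_interior_disjoint_vertices: "e \<in> mE M \<Longrightarrow> edge_interior M e \<inter> mV M = {}"
    and edge_interiors_disjoint:
      "\<lbrakk>e \<in> mE M; f \<in> mE M; e \<noteq> f\<rbrakk> \<Longrightarrow> edge_interior M e \<inter> edge_interior M f = {}"
    and points_eq: "points \<Gamma> = mV M \<union> \<Union> (mE M)"
    and tc_dist_eq: "\<lbrakk>x \<in> points \<Gamma>; y \<in> points \<Gamma>\<rbrakk> \<Longrightarrow> tc_dist \<Gamma> x y = Inf {r. path_length M x y r}"
  using is_model unfolding is_model_def multigraph_def by (elim conjE, simp)+

lemma openin_iff:
  assumes "U \<subseteq> points \<Gamma>"
  shows "openin (tc_top \<Gamma>) U \<longleftrightarrow>
          (\<forall>e\<in>mE M. openin (top_of_set {0..len M e}) {t \<in> {0..len M e}. chart M e t \<in> U})"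
  using is_model unfolding is_model_def by (elim conjE allE[of _ U] impE[OF _ assms])

lemma chart_in_edge: "\<lbrakk>e \<in> mE M; t \<in> {0..len M e}\<rbrakk> \<Longrightarrow> chart M e t \<in> e"
  using chart_image by blast

lemma edge_subset_points: "e \<in> mE M \<Longrightarrow> e \<subseteq> points \<Gamma>"
  using points_eq by blast

lemma chart_ends_in_vertices: "e \<in> mE M \<Longrightarrow> {chart M e 0, chart M e (len M e)} \<subseteq> mV M"
  using ends_in_vertices[of e] ends_eq[of e] by simp

lemma chart_ends_distinct: "e \<in> mE M \<Longrightarrow> chart M e 0 \<noteq> chart M e (len M e)"
  using loopless ends_eq unfolding loopless_def by force

lemma edge_decomposition:
  assumes "e \<in> mE M"
  shows "e = edge_interior M e \<union> {chart M e 0, chart M e (len M e)}"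
proof -
  have "{0..len M e} = {0<..<len M e} \<union> {0, len M e}"
    using len_pos[OF assms] by auto
  then show ?thesis
    using chart_image[OF assms] unfolding edge_interior_def by blast
qed

lemma edge_interior_subset: "e \<in> mE M \<Longrightarrow> edge_interior M e \<subseteq> e"
  using edge_decomposition by blast

lemma edge_Int_vertices: "e \<in> mE M \<Longrightarrow> e \<inter> mV M = {chart M e 0, chart M e (len M e)}"
  using edge_decomposition chart_ends_in_vertices edge_interior_disjoint_vertices by blast

lemma edge_interior_eq: "e \<in> mE M \<Longrightarrow> edge_interior M e = e - mV M"
  using edge_decomposition chart_ends_in_vertices edge_interior_disjoint_vertices by blast

lemma incident_iff: "e \<in> mE M \<Longrightarrow> v \<in># ends (graph M) e \<longleftrightarrow> v \<in> e \<and> v \<in> mV M"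
  using edge_Int_vertices ends_eq by auto

lemma interior_edge_unique:
  "\<lbrakk>e \<in> mE M; f \<in> mE M; x \<in> edge_interior M e; x \<in> f\<rbrakk> \<Longrightarrow> f = e"
  using edge_interiors_disjoint edge_interior_eq edge_interior_disjoint_vertices by blast

lemma chart_mem_interior:
  "\<lbrakk>t \<in> {0..len M e}; t \<noteq> 0; t \<noteq> len M e\<rbrakk> \<Longrightarrow> chart M e t \<in> edge_interior M e"
  unfolding edge_interior_def by (intro imageI) auto

lemma chart_inj:
  assumes "e \<in> mE M" shows "inj_on (chart M e) {0..len M e}"
proof (rule inj_onI)
  fix s t assume s: "s \<in> {0..len M e}" and t: "t \<in> {0..len M e}" and eq: "chart M e s = chart M e t"
  have V: "chart M e r \<in> mV M \<longleftrightarrow> r = 0 \<or> r = len M e" if "r \<in> {0..len M e}" for r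
    using chart_mem_interior[OF that] chart_ends_in_vertices[OF assms]
      edge_interior_disjoint_vertices[OF assms] by blast
  show "s = t"
  proof (cases "chart M e s \<in> mV M")
    case True
    then show ?thesis
      using V[OF s] V[OF t] eq chart_ends_distinct[OF assms] by metis
  next
    case False
    then have "s \<in> {0<..<len M e}" "t \<in> {0<..<len M e}"
      using V[OF s] V[OF t] eq s t chart_ends_in_vertices[OF assms] by auto
    then show ?thesis
      using chart_inj_interior[OF assms] eq by (meson inj_onD)
  qed
qed

lemma chart_eq_interior:
  assumes "e \<in> mE M" "f \<in> mE M" "t \<in> {0<..<len M e}" "s \<in> {0..len M f}" "chart M e t = chart M f s"
  shows "f = e \<and> s = t"
proof -
  have "chart M e t \<in> edge_interior M e" using assms(3) by (simp add: edge_interior_def)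
  moreover have "chart M e t \<in> f" using chart_in_edge assms by metis
  ultimately have "f = e" using interior_edge_unique assms by blast
  then show ?thesis
    using inj_on_eq_iff[OF chart_inj[OF assms(1)], of t s] assms(3-5) less_imp_le by auto
qed

lemma closedin_iff:
  assumes "C \<subseteq> points \<Gamma>"
  shows "closedin (tc_top \<Gamma>) C \<longleftrightarrow>
    (\<forall>e\<in>mE M. closedin (top_of_set {0..len M e}) {t \<in> {0..len M e}. chart M e t \<in> C})"
proof -
  have *: "{t \<in> {0..len M e}. chart M e t \<in> points \<Gamma> - C} =
        {0..len M e} - {t \<in> {0..len M e}. chart M e t \<in> C}" if "e \<in> mE M" for e
    using chart_in_edge[OF that] edge_subset_points[OF that] by blast
  have "closedin (tc_top \<Gamma>) C \<longleftrightarrow> openin (tc_top \<Gamma>) (points \<Gamma> - C)"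
    using assms by (simp add: closedin_def)
  also have "\<dots> \<longleftrightarrow> (\<forall>e\<in>mE M. openin (top_of_set {0..len M e})
      ({0..len M e} - {t \<in> {0..len M e}. chart M e t \<in> C}))"
    using openin_iff[of "points \<Gamma> - C"] * by simp
  also have "\<dots> \<longleftrightarrow> (\<forall>e\<in>mE M. closedin (top_of_set {0..len M e}) {t \<in> {0..len M e}. chart M e t \<in> C})"
    unfolding closedin_def by (intro ball_cong refl) auto
  finally show ?thesis .
qed

lemma continuous_map_chart:
  assumes "e \<in> mE M"
  shows "continuous_map (top_of_set {0..len M e}) (tc_top \<Gamma>) (chart M e)"
proof -
  have "chart M e ` {0..len M e} \<subseteq> points \<Gamma>"
    using chart_image[OF assms] edge_subset_points[OF assms] by simp
  moreover have "openin (top_of_set {0..len M e}) {t \<in> {0..len M e}. chart M e t \<in> U}"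
    if "openin (tc_top \<Gamma>) U" for U
    using openin_iff[OF openin_subset[OF that]] that assms by blast
  ultimately show ?thesis
    unfolding continuous_map_def topspace_euclidean_subtopology by blast
qed

text \<open>Under any other chart, the preimage of a subset of \<open>e\<close> consists of endpoints only, so only the
  chart of \<open>e\<close> itself has to be looked at.\<close>

lemma closed_map_chart:
  assumes e: "e \<in> mE M"
  shows "closed_map (top_of_set {0..len M e}) (tc_top \<Gamma>) (chart M e)"
  unfolding closed_map_def
proof (intro allI impI)
  fix K assume K: "closedin (top_of_set {0..len M e}) K"
  then have KI: "K \<subseteq> {0..len M e}" using closedin_subset by force
  then have KP: "chart M e ` K \<subseteq> points \<Gamma>"
    using chart_in_edge[OF e] edge_subset_points[OF e] by blast
  have "closedin (top_of_set {0..len M f}) {t \<in> {0..len M f}. chart M f t \<in> chart M e ` K}"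
    if f: "f \<in> mE M" for f
  proof (cases "f = e")
    case True
    have "{t \<in> {0..len M e}. chart M e t \<in> chart M e ` K} = K"
      using KI chart_inj[OF e] by (auto dest: inj_onD)
    then show ?thesis using K True by simp
  next
    case False
    have "{t \<in> {0..len M f}. chart M f t \<in> chart M e ` K} \<subseteq> {0, len M f}"
    proof (rule ccontr)
      assume "\<not> ?thesis"
      then obtain t s where "t \<in> {0<..<len M f}" "s \<in> K" "chart M f t = chart M e s" 
        by (auto simp: less_le)
      then show False using chart_eq_interior[OF f e, of t s] KI False by blast
    qed
    then have "finite {t \<in> {0..len M f}. chart M f t \<in> chart M e ` K}"
      by (rule finite_subset) simp
    then show ?thesis
      by (metis (no_types, lifting) closed_subset finite_imp_closed mem_Collect_eq subsetI)
  qed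
  then show "closedin (tc_top \<Gamma>) (chart M e ` K)"
    using closedin_iff[OF KP] by blast
qed

lemma closedin_edge:
  assumes "e \<in> mE M" shows "closedin (tc_top \<Gamma>) e"
  using closed_map_chart[OF assms] chart_image[OF assms] unfolding closed_map_def
  by (metis closedin_topspace topspace_euclidean_subtopology)

lemma closedin_finite:
  assumes "finite F" "F \<subseteq> points \<Gamma>" shows "closedin (tc_top \<Gamma>) F"
proof -
  have "closedin (top_of_set {0..len M e}) {t \<in> {0..len M e}. chart M e t \<in> F}" if e: "e \<in> mE M" for e
  proof -
    have "finite {t \<in> {0..len M e}. chart M e t \<in> F}"
      using inj_on_finite[of "chart M e" "{t \<in> {0..len M e}. chart M e t \<in> F}" F] assms(1)
        inj_on_subset[OF chart_inj[OF e], of "{t \<in> {0..len M e}. chart M e t \<in> F}"] by blast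
    then show ?thesis
      by (metis (no_types, lifting) closed_subset finite_imp_closed mem_Collect_eq subsetI)
  qed
  then show ?thesis using closedin_iff[OF assms(2)] by blast
qed

lemma openin_edge_interior:
  assumes "e \<in> mE M" shows "openin (tc_top \<Gamma>) (edge_interior M e)"
proof -
  have "edge_interior M e \<subseteq> points \<Gamma>"
    using edge_interior_subset[OF assms] edge_subset_points[OF assms] by blast
  moreover have "openin (top_of_set {0..len M f}) {t \<in> {0..len M f}. chart M f t \<in> edge_interior M e}"
    if f: "f \<in> mE M" for f
  proof (cases "f = e")
    case True
    have "{t \<in> {0..len M e}. chart M e t \<in> edge_interior M e} = {0<..<len M e}"
    proof (intro equalityI subsetI)
      fix t assume "t \<in> {t \<in> {0..len M e}. chart M e t \<in> edge_interior M e}"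
      then obtain s where "s \<in> {0<..<len M e}" "chart M e s = chart M e t" "t \<in> {0..len M e}"
        unfolding edge_interior_def by auto
      then show "t \<in> {0<..<len M e}"
        using chart_eq_interior[OF assms assms] by metis
    qed (auto simp: edge_interior_def less_imp_le)
    moreover have "openin (top_of_set {0..len M e}) {0<..<len M e}"
      by (rule open_subset) auto
    ultimately show ?thesis using True by simp
  next
    case False
    then have "{t \<in> {0..len M f}. chart M f t \<in> edge_interior M e} = {}"
      using chart_in_edge[OF f] interior_edge_unique[OF assms f] by blast
    then show ?thesis by (simp only: openin_empty)
  qed
  ultimately show ?thesis using openin_iff by blast
qed

lemma connectedin_edge_interior:
  assumes "e \<in> mE M" shows "connectedin (tc_top \<Gamma>) (edge_interior M e)"
  unfolding edge_interior_def
  by (rule connectedin_continuous_map_image[OF continuous_map_chart[OF assms]])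
     (auto simp: connectedin_subtopology)

lemma connectedin_edge:
  assumes "e \<in> mE M" shows "connectedin (tc_top \<Gamma>) e"
proof -
  have "connectedin (tc_top \<Gamma>) (chart M e ` {0..len M e})"
    by (rule connectedin_continuous_map_image[OF continuous_map_chart[OF assms]])
     (auto simp: connectedin_subtopology)
  then show ?thesis by (simp add: chart_image[OF assms])
qed

lemma closure_of_edge_interior:
  assumes "e \<in> mE M" shows "tc_top \<Gamma> closure_of edge_interior M e = e"
proof
  show "tc_top \<Gamma> closure_of edge_interior M e \<subseteq> e"
    by (rule closure_of_minimal[OF edge_interior_subset[OF assms] closedin_edge[OF assms]])
  have "top_of_set {0..len M e} closure_of {0<..<len M e} = {0..len M e}"
    using len_pos[OF assms] by (simp add: closure_of_subtopology Int_absorb1 greaterThanLessThan_subseteq_atLeastAtMost_iff)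
  then show "e \<subseteq> tc_top \<Gamma> closure_of edge_interior M e"
    using continuous_map_image_closure_subset[OF continuous_map_chart[OF assms], of "{0<..<len M e}"]
    by (simp add: chart_image[OF assms] edge_interior_def)
qed

lemma infinite_edge_interior:
  assumes "e \<in> mE M" shows "infinite (edge_interior M e)"
proof -
  have "infinite {0<..<len M e}"
    using infinite_Ioo[OF len_pos[OF assms]] .
  then show ?thesis
    using chart_inj_interior[OF assms] by (simp add: edge_interior_def finite_image_iff)
qed

lemma edge_interior_nonempty: "e \<in> mE M \<Longrightarrow> edge_interior M e \<noteq> {}"
  using infinite_edge_interior by fastforce

lemma points_off_vertices: "points \<Gamma> - mV M = (\<Union>e\<in>mE M. edge_interior M e)"
  using points_eq edge_interior_eq by blast

text \<open>The edge interiors form an open partition of the complement of the vertices; they are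
  therefore its connected components.\<close>

lemma connectedin_off_vertices:
  assumes C: "connectedin (tc_top \<Gamma>) C" "C \<inter> mV M = {}" "C \<noteq> {}"
  obtains e where "e \<in> mE M" "C \<subseteq> edge_interior M e"
proof -
  have CP: "C \<subseteq> points \<Gamma>" using C(1) by (rule connectedin_subset_topspace)
  obtain x where x: "x \<in> C" using C(3) by blast
  then obtain e where e: "e \<in> mE M" "x \<in> edge_interior M e"
    using points_off_vertices CP C(2) by blast
  define W where "W = (\<Union>f\<in>mE M - {e}. edge_interior M f)"
  have W: "openin (tc_top \<Gamma>) W" unfolding W_def by (auto intro: openin_edge_interior)
  have "C \<subseteq> edge_interior M e \<union> W"
    using CP C(2) points_off_vertices unfolding W_def by blast
  moreover have "edge_interior M e \<inter> W \<inter> C = {}"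
    using edge_interiors_disjoint e(1) unfolding W_def by blast
  ultimately have "W \<inter> C = {}"
    using C(1) W openin_edge_interior[OF e(1)] x e(2) unfolding connectedin by blast
  then have "C \<subseteq> edge_interior M e" using \<open>C \<subseteq> edge_interior M e \<union> W\<close> by blast
  then show ?thesis using that e(1) by blast
qed

lemma Hausdorff_space_edge:
  assumes "e \<in> mE M" shows "Hausdorff_space (subtopology (tc_top \<Gamma>) e)"
proof -
  have ereal: "Hausdorff_space (euclidean :: ereal topology)"
    unfolding Hausdorff_space_def disjnt_def using hausdorff[where ?'a = ereal] by fastforce
  have "embedding_map (top_of_set {0..len M e}) (tc_top \<Gamma>) (chart M e)"
    by (rule injective_closed_imp_embedding_map)
       (simp_all add: continuous_map_chart closed_map_chart chart_inj assms)
  then have "top_of_set {0..len M e} homeomorphic_space subtopology (tc_top \<Gamma>) e"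
    using embedding_map_imp_homeomorphic_space chart_image[OF assms] by fastforce
  then show ?thesis
    using homeomorphic_Hausdorff_space[of "top_of_set {0..len M e}" "subtopology (tc_top \<Gamma>) e"]
      Hausdorff_space_subtopology[OF ereal, of "{0..len M e}"] by simp
qed

lemma compactin_edge:
  assumes "e \<in> mE M" shows "compactin (tc_top \<Gamma>) e"
  using image_compactin[OF _ continuous_map_chart[OF assms], of "{0..len M e}"] chart_image[OF assms]
  by (simp add: compactin_subtopology compact_eq_closed)

text \<open>An edge is an arc, so a connected part of it that contains both ends is everything: were a
  point \<open>chart e t\<close> missing, the images of \<open>{0..<t}\<close> and \<open>{t<..len e}\<close> would disconnect it.\<close>

lemma connectedin_between_ends:
  assumes e: "e \<in> mE M" and C: "connectedin (tc_top \<Gamma>) C" "C \<subseteq> e" "e \<inter> mV M \<subseteq> C"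
  shows "C = e"
proof (rule ccontr)
  assume "C \<noteq> e"
  then obtain t where t: "t \<in> {0..len M e}" "chart M e t \<notin> C"
    using C(2) chart_image[OF e] by (metis imageE subsetI subset_antisym)
  define A where "A = chart M e ` {0..t}"
  define B where "B = chart M e ` {t..len M e}"
  have "closedin (top_of_set {0..len M e}) {0..t}" "closedin (top_of_set {0..len M e}) {t..len M e}"
    using t(1) by (auto intro!: closed_subset)
  then have "closedin (tc_top \<Gamma>) A" "closedin (tc_top \<Gamma>) B"
    using closed_map_chart[OF e] unfolding closed_map_def A_def B_def by blast+
  moreover have "C \<subseteq> A \<union> B"
  proof -
    have "{0..len M e} = {0..t} \<union> {t..len M e}" using t(1) by auto
    then have "e = A \<union> B" unfolding A_def B_def using chart_image[OF e] by (metis image_Un)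
    then show ?thesis using C(2) by blast
  qed
  moreover have "A \<inter> B \<inter> C = {}"
  proof (rule ccontr)
    assume "A \<inter> B \<inter> C \<noteq> {}"
    then obtain x where x: "x \<in> A" "x \<in> B" "x \<in> C" by blast
    then obtain r s where "x = chart M e r" "x = chart M e s" "r \<in> {0..t}" "s \<in> {t..len M e}"
      unfolding A_def B_def by blast
    moreover then have "r = s" using chart_inj[OF e] t(1) by (auto dest!: inj_onD)
    ultimately have "x = chart M e t" by force
    then show False using x(3) t(2) by blast
  qed
  moreover have "chart M e 0 \<in> A \<inter> C" "chart M e (len M e) \<in> B \<inter> C"
    using C(3) edge_Int_vertices[OF e] t(1) unfolding A_def B_def by auto
  ultimately show False
    using C(1) unfolding connectedin_closedin by blast
qed

end

section \<open>Subdivision of a model\<close>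

lemma continuous_on_add_left_ereal:
  fixes c :: ereal assumes "\<bar>c\<bar> \<noteq> \<infinity>" shows "continuous_on UNIV (\<lambda>t. c + t)"
  unfolding continuous_on_def
  by (intro ballI tendsto_add_ereal_general2[OF assms] tendsto_const tendsto_ident_at)

lemma closed_shift_ereal_iff:
  fixes c L :: ereal
  assumes "\<bar>c\<bar> \<noteq> \<infinity>"
  shows "closed {t \<in> {0..L - c}. Q (c + t)} \<longleftrightarrow> closed {u \<in> {c..L}. Q u}"
proof -
  obtain r where r: "c = ereal r" using assms by (cases c) auto
  have 1: "{t \<in> {0..L - c}. Q (c + t)} = (\<lambda>t. c + t) -` {u \<in> {c..L}. Q u}"
  proof -
    have "c + t \<in> {c..L} \<longleftrightarrow> t \<in> {0..L - c}" for t
      unfolding r by (cases t; cases L) auto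
    then show ?thesis by auto
  qed
  have 2: "{u \<in> {c..L}. Q u} = (\<lambda>u. - c + u) -` {t \<in> {0..L - c}. Q (c + t)}"
  proof -
    have "- c + u \<in> {0..L - c} \<longleftrightarrow> u \<in> {c..L}" "c + (- c + u) = u" for u
      unfolding r by (cases u; cases L; auto)+
    then show ?thesis by auto
  qed
  have "\<bar>- c\<bar> \<noteq> \<infinity>" using r by simp
  then show ?thesis
    using closed_vimage[OF _ continuous_on_add_left_ereal[OF assms], of "{u \<in> {c..L}. Q u}"]
      closed_vimage[OF _ continuous_on_add_left_ereal, of "{t \<in> {0..L - c}. Q (c + t)}" "- c"] 1 2
    by metis
qed

text \<open>For closed sets in place of open ones, splitting \<open>[0, L]\<close> at \<open>c\<close> is a matter of unions and
  intersections with closed intervals, and moving \<open>[c, L]\<close> to \<open>[0, L - c]\<close> is a homeomorphism of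
  the extended reals because \<open>c\<close> is finite.\<close>

lemma openin_interval_split:
  fixes c L :: ereal
  assumes "c \<in> {0<..<L}"
  shows "openin (top_of_set {0..L}) {t \<in> {0..L}. P t} \<longleftrightarrow>
    openin (top_of_set {0..c}) {t \<in> {0..c}. P t} \<and>
    openin (top_of_set {0..L - c}) {t \<in> {0..L - c}. P (c + t)}"
proof -
  have c: "\<bar>c\<bar> \<noteq> \<infinity>" using assms by auto
  have *: "openin (top_of_set {a..b}) {t \<in> {a..b}. R t} \<longleftrightarrow> closed {t \<in> {a..b}. \<not> R t}"
    for a b :: ereal and R
  proof -
    have "{a..b} - {t \<in> {a..b}. R t} = {t \<in> {a..b}. \<not> R t}" by auto
    moreover have "{t \<in> {a..b}. R t} \<subseteq> {a..b}" "{t \<in> {a..b}. \<not> R t} \<subseteq> {a..b}" by auto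
    ultimately show ?thesis
      by (simp only: openin_closedin_eq topspace_euclidean_subtopology simp_thms
          closedin_closed_eq[OF closed_atLeastAtMost])
  qed
  have "closed {t \<in> {0..L}. \<not> P t} \<longleftrightarrow> closed {t \<in> {0..c}. \<not> P t} \<and> closed {t \<in> {c..L}. \<not> P t}"
  proof
    assume "closed {t \<in> {0..L}. \<not> P t}"
    moreover have "{t \<in> {0..c}. \<not> P t} = {t \<in> {0..L}. \<not> P t} \<inter> {0..c}"
      "{t \<in> {c..L}. \<not> P t} = {t \<in> {0..L}. \<not> P t} \<inter> {c..L}"
      using assms by auto
    ultimately show "closed {t \<in> {0..c}. \<not> P t} \<and> closed {t \<in> {c..L}. \<not> P t}"
      by (metis closed_Int closed_atLeastAtMost)
  next
    assume "closed {t \<in> {0..c}. \<not> P t} \<and> closed {t \<in> {c..L}. \<not> P t}"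
    moreover have "{t \<in> {0..L}. \<not> P t} = {t \<in> {0..c}. \<not> P t} \<union> {t \<in> {c..L}. \<not> P t}"
      using assms by auto
    ultimately show "closed {t \<in> {0..L}. \<not> P t}" by (simp only: closed_Un)
  qed
  then show ?thesis
    unfolding * using closed_shift_ereal_iff[OF c, of L "\<lambda>t. \<not> P t"] by simp
qed

locale edge_subdivision = loopless_model +
  fixes e :: "'a set" and c :: ereal
  assumes e: "e \<in> mE M" and c: "c \<in> {0<..<len M e}"
begin

definition first_part :: "'a set" where "first_part = chart M e ` {0..c}"
definition second_part :: "'a set" where "second_part = chart M e ` {c..len M e}"

text \<open>The second part is parametrized from \<open>c\<close> on. As \<open>\<infinity> - c = \<infinity>\<close>, a point at infinity keeps the
  parameter \<open>\<infinity>\<close>.\<close>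

definition subdivision :: "'a tmodel" where
  "subdivision = \<lparr>
     graph = \<lparr>
       verts = insert (chart M e c) (mV M),
       edges = insert first_part (insert second_part (mE M - {e})),
       ends = (ends (graph M))
         (first_part := {#chart M e 0, chart M e c#},
          second_part := {#chart M e c, chart M e (len M e)#})\<rparr>,
     len = (len M)(first_part := c, second_part := len M e - c),
     chart = (chart M)(second_part := \<lambda>t. chart M e (c + t), first_part := chart M e)\<rparr>"

lemma c_finite: "\<bar>c\<bar> \<noteq> \<infinity>" using c by auto

lemma c_bounds: "0 < c" "c < len M e" "0 \<le> c" "c \<le> len M e"
  using c by (auto simp: less_imp_le)

lemma parts_union: "first_part \<union> second_part = e"
proof -
  have "{0..len M e} = {0..c} \<union> {c..len M e}" using c_bounds by auto
  then show ?thesis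
    unfolding first_part_def second_part_def using chart_image[OF e] by (metis image_Un)
qed

lemma cut_interior: "chart M e c \<in> edge_interior M e"
  using c by (simp add: edge_interior_def)

lemma cut_not_vertex: "chart M e c \<notin> mV M"
  using cut_interior edge_interior_disjoint_vertices[OF e] by blast

lemma parts_distinct:
  "first_part \<notin> mE M" "second_part \<notin> mE M" "first_part \<noteq> second_part"
proof -
  have "chart M e (len M e) \<notin> first_part" "chart M e 0 \<notin> second_part"
    using inj_on_image_mem_iff[OF chart_inj[OF e], of "len M e" "{0..c}"]
      inj_on_image_mem_iff[OF chart_inj[OF e], of 0 "{c..len M e}"] c_bounds
    unfolding first_part_def second_part_def by auto
  moreover have "chart M e c \<in> first_part" "chart M e c \<in> second_part"
    and "chart M e 0 \<in> first_part"
    using c_bounds unfolding first_part_def second_part_def by auto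
  moreover have "chart M e 0 \<in> e" "chart M e (len M e) \<in> e"
    using chart_in_edge[OF e] len_pos[OF e] by auto
  ultimately show "first_part \<notin> mE M" "second_part \<notin> mE M" "first_part \<noteq> second_part"
    using interior_edge_unique[OF e _ cut_interior] by blast+
qed

lemma subdivision_simps [simp]:
  shows "mV subdivision = insert (chart M e c) (mV M)"
    and "mE subdivision = insert first_part (insert second_part (mE M - {e}))"
    and "ends (graph subdivision) first_part = {#chart M e 0, chart M e c#}"
    and "ends (graph subdivision) second_part = {#chart M e c, chart M e (len M e)#}"
    and "len subdivision first_part = c"
    and "len subdivision second_part = len M e - c"
    and "chart subdivision first_part = chart M e"
    and "chart subdivision second_part = (\<lambda>t. chart M e (c + t))"
    and "f \<in> mE M \<Longrightarrow> ends (graph subdivision) f = ends (graph M) f"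
    and "f \<in> mE M \<Longrightarrow> len subdivision f = len M f"
    and "f \<in> mE M \<Longrightarrow> chart subdivision f = chart M f"
  using parts_distinct by (auto simp: subdivision_def)

lemma ball_subdivision_iff:
  "(\<forall>f\<in>mE subdivision. P f) \<longleftrightarrow> P first_part \<and> P second_part \<and> (\<forall>f\<in>mE M - {e}. P f)"
  by simp

lemma shift_mem_iff: "c + t \<in> {c..len M e} \<longleftrightarrow> t \<in> {0..len M e - c}"
  "c + t \<in> {c<..<len M e} \<longleftrightarrow> t \<in> {0<..<len M e - c}"
  using c_finite by (cases c; cases t; cases "len M e"; auto)+

lemma shift_cancel: "c + (u - c) = u"
  using c_finite by (cases c; cases u; auto)

lemma shift_image: "(\<lambda>t. c + t) ` {0..len M e - c} = {c..len M e}"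
  "(\<lambda>t. c + t) ` {0<..<len M e - c} = {c<..<len M e}"
  using shift_mem_iff shift_cancel by (metis (no_types, lifting) image_iff subsetI subset_antisym)+

lemma edge_interior_parts:
  "edge_interior subdivision first_part = chart M e ` {0<..<c}"
  "edge_interior subdivision second_part = chart M e ` {c<..<len M e}"
  "f \<in> mE M \<Longrightarrow> edge_interior subdivision f = edge_interior M f"
  unfolding edge_interior_def by (simp_all flip: shift_image image_image)

lemma edge_interior_parts_subset:
  "edge_interior subdivision first_part \<subseteq> edge_interior M e - {chart M e c}"
  "edge_interior subdivision second_part \<subseteq> edge_interior M e - {chart M e c}"
  "edge_interior subdivision first_part \<inter> edge_interior subdivision second_part = {}"
proof -
  have *: "chart M e s = chart M e t \<longleftrightarrow> s = t" if "s \<in> {0<..<len M e}" "t \<in> {0<..<len M e}" for s t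
    using chart_inj_interior[OF e] that by (meson inj_on_eq_iff)
  have "chart M e s \<in> edge_interior M e - {chart M e c}" if "s \<in> {0<..<len M e} - {c}" for s
    using that * c by (auto simp: edge_interior_def)
  then have cut: "chart M e ` ({0<..<len M e} - {c}) \<subseteq> edge_interior M e - {chart M e c}"
    by (rule image_subsetI)
  have "{0<..<c} \<subseteq> {0<..<len M e} - {c}" "{c<..<len M e} \<subseteq> {0<..<len M e} - {c}"
    using c_bounds by auto
  note parts = this[THEN image_mono, THEN subset_trans, OF cut]
  show "edge_interior subdivision first_part \<subseteq> edge_interior M e - {chart M e c}"
    "edge_interior subdivision second_part \<subseteq> edge_interior M e - {chart M e c}"
    unfolding edge_interior_parts(1,2) by (fact parts)+
  have "s \<noteq> t" if "s \<in> {0<..<c}" "t \<in> {c<..<len M e}" for s t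
    using that by auto
  moreover have "{0<..<c} \<subseteq> {0<..<len M e}" "{c<..<len M e} \<subseteq> {0<..<len M e}"
    using c_bounds by auto
  ultimately show "edge_interior subdivision first_part \<inter> edge_interior subdivision second_part = {}"
    unfolding edge_interior_parts using * by (auto simp: subset_iff)
qed

lemma valency_subdivision:
  assumes "v \<noteq> chart M e c" shows "valency (graph subdivision) v = valency (graph M) v"
proof -
  have "valency (graph subdivision) v =
      count {#chart M e 0, chart M e c#} v + count {#chart M e c, chart M e (len M e)#} v
        + (\<Sum>f\<in>mE M - {e}. count (ends (graph M) f) v)"
    unfolding valency_def using parts_distinct finite_edges by simp
  also have "\<dots> = count (ends (graph M) e) v + (\<Sum>f\<in>mE M - {e}. count (ends (graph M) f) v)"
    using assms ends_eq[OF e] by simp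
  also have "\<dots> = valency (graph M) v"
    unfolding valency_def using sum.remove[OF finite_edges e] by metis
  finally show ?thesis .
qed

lemma leaf_end_subdivision: "leaf_end (graph M) v \<Longrightarrow> leaf_end (graph subdivision) v"
  using valency_subdivision[of v] cut_not_vertex unfolding leaf_end_def by auto

text \<open>Of the two parts of \<open>e\<close> only the second can be infinite, and it keeps the infinite leaf end of \<open>e\<close>.\<close>

lemma infinite_edge_subdivision:
  assumes "f \<in> mE subdivision" "len subdivision f = \<infinity>"
  shows "leaf_edge (graph subdivision) f \<and> leaf_end (graph subdivision) (chart subdivision f \<infinity>)"
proof -
  have M: "leaf_edge (graph M) h \<and> leaf_end (graph M) (chart M h \<infinity>)"
    if "h \<in> mE M" "len M h = \<infinity>" for h
    using is_model that unfolding is_model_def by (elim conjE) simp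
  consider "f = first_part" | "f = second_part" | "f \<in> mE M" "f \<noteq> e"
    using assms(1) by auto
  then show ?thesis
  proof cases
    case 1
    then show ?thesis using assms(2) c_finite by simp
  next
    case 2
    then have "len M e - c = \<infinity>" using assms(2) by simp
    then have "len M e = \<infinity>"
      using c_finite by (cases "len M e"; cases c) auto
    then have "leaf_end (graph subdivision) (chart M e \<infinity>)" "chart M e \<infinity> \<in># ends (graph subdivision) f"
      using M[OF e] leaf_end_subdivision 2 by auto
    moreover have "c + \<infinity> = \<infinity>" using c_finite by (cases c) auto
    ultimately show ?thesis using 2 unfolding leaf_edge_def by auto
  next
    case 3
    then show ?thesis
      using M[of f] assms(2) leaf_end_subdivision unfolding leaf_edge_def by auto
  qed
qed

lemma multigraph_subdivision: "multigraph (graph subdivision)"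
proof -
  define A where "A = {(a, b). \<exists>f\<in>mE M. ends (graph M) f = {#a, b#}}"
  define B where "B = {(a, b). \<exists>f\<in>mE subdivision. ends (graph subdivision) f = {#a, b#}}"
  have part: "(chart M e 0, chart M e c) \<in> B" "(chart M e c, chart M e 0) \<in> B"
    "(chart M e c, chart M e (len M e)) \<in> B" "(chart M e (len M e), chart M e c) \<in> B"
    unfolding B_def by (auto simp: add_mset_commute)
  have "A \<subseteq> B\<^sup>*"
  proof
    fix x assume "x \<in> A"
    then obtain a b f where x: "x = (a, b)" "f \<in> mE M" "ends (graph M) f = {#a, b#}"
      unfolding A_def by auto
    show "x \<in> B\<^sup>*"
    proof (cases "f = e")
      case True
      then have "{#a, b#} = {#chart M e 0, chart M e (len M e)#}" using x ends_eq[OF e] by metis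
      then have "a = chart M e 0 \<and> b = chart M e (len M e) \<or> a = chart M e (len M e) \<and> b = chart M e 0"
        by (auto simp: add_eq_conv_ex)
      then show ?thesis
        using part x(1) by (meson r_into_rtrancl rtrancl_trans)
    next
      case False
      then have "x \<in> B" unfolding B_def using x by auto
      then show ?thesis by blast
    qed
  qed
  then have AB: "A\<^sup>* \<subseteq> B\<^sup>*" by (metis rtrancl_mono rtrancl_idemp)
  have A: "(u, v) \<in> A\<^sup>*" if "u \<in> mV M" "v \<in> mV M" for u v
    using is_model that unfolding is_model_def multigraph_def A_def by (elim conjE) simp
  have "chart M e 0 \<in> mV M" using chart_ends_in_vertices[OF e] by blast
  then have "(u, chart M e 0) \<in> B\<^sup>* \<and> (chart M e 0, u) \<in> B\<^sup>*" if "u \<in> mV subdivision" for u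
    using that A AB part by auto
  then have "(u, v) \<in> B\<^sup>*" if "u \<in> mV subdivision" "v \<in> mV subdivision" for u v
    using that by (meson rtrancl_trans)
  moreover have "size (ends (graph subdivision) f) = 2 \<and>
      set_mset (ends (graph subdivision) f) \<subseteq> mV subdivision" if "f \<in> mE subdivision" for f
    using that ends_in_vertices ends_eq chart_ends_in_vertices[OF e] by auto
  ultimately show ?thesis
    unfolding multigraph_def B_def using finite_vertices finite_edges by simp
qed

text \<open>A segment of \<open>e\<close> that crosses the new vertex is cut there into two segments with the same total
  length. Hence the distance of \<open>\<Gamma>\<close> is the path distance of the subdivision as well.\<close>

lemma path_length_subdivision_iff: "path_length subdivision x y r \<longleftrightarrow> path_length M x y r"
proof
  assume "path_length subdivision x y r"
  then show "path_length M x y r"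
  proof induction
    case (empty x)
    show ?case by (rule path_length.empty)
  next
    case (segment x f s r t)
    from segment.hyps(2) consider "f = first_part" | "f = second_part" | "f \<in> mE M" by auto
    then show ?case
    proof cases
      case 1
      then show ?thesis
        using path_length.segment[of M x e s r t] segment e c_bounds by auto
    next
      case 2
      have "c + s \<in> {0..len M e}" "c + t \<in> {0..len M e}"
        using shift_mem_iff(1)[of s] shift_mem_iff(1)[of t] segment.hyps(3,4) 2 c_bounds by auto
      moreover have "\<bar>(c + s) - (c + t)\<bar> = \<bar>s - t\<bar>"
        using c_finite by (cases c; cases s; cases t; auto)
      ultimately show ?thesis
        using path_length.segment[of M x e "c + s" r "c + t"] segment.IH e 2 by simp
    next
      case 3
      then show ?thesis
        using path_length.segment[of M x f s r t] segment by simp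
    qed
  qed
next
  have first: "path_length subdivision x (chart M e t) (r + \<bar>s - t\<bar>)"
    if "path_length subdivision x (chart M e s) r" "s \<in> {0..c}" "t \<in> {0..c}" for x r s t
    using path_length.segment[of subdivision x first_part s r t] that by simp
  have second: "path_length subdivision x (chart M e t) (r + \<bar>s - t\<bar>)"
    if "path_length subdivision x (chart M e s) r" "s \<in> {c..len M e}" "t \<in> {c..len M e}" for x r s t
  proof -
    have "s - c \<in> {0..len M e - c}" "t - c \<in> {0..len M e - c}"
      using that shift_mem_iff(1) shift_cancel by metis+
    moreover have "\<bar>(s - c) - (t - c)\<bar> = \<bar>s - t\<bar>"
      using c_finite by (cases c; cases s; cases t; auto)
    ultimately show ?thesis
      using path_length.segment[of subdivision x second_part "s - c" r "t - c"] that(1)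
      by (simp add: shift_cancel)
  qed
  assume "path_length M x y r"
  then show "path_length subdivision x y r"
  proof induction
    case (empty x)
    show ?case by (rule path_length.empty)
  next
    case (segment x f s r t)
    show ?case
    proof (cases "f = e")
      case False
      then show ?thesis
        using path_length.segment[of subdivision x f s r t] segment by simp
    next
      case True
      have s: "s \<in> {0..c} \<or> s \<in> {c..len M e}" and t: "t \<in> {0..c} \<or> t \<in> {c..len M e}"
        using segment.hyps(3,4) True by auto
      have mid: "c \<in> {0..c}" "c \<in> {c..len M e}" using c_bounds by auto
      have IH: "path_length subdivision x (chart M e s) r" using segment.IH True by simp
      have via: "r + \<bar>s - t\<bar> = (r + \<bar>s - c\<bar>) + \<bar>c - t\<bar>"
        if "s \<le> c \<and> c \<le> t \<or> t \<le> c \<and> c \<le> s"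
      proof -
        have "\<bar>s - t\<bar> = \<bar>s - c\<bar> + \<bar>c - t\<bar>"
          using that c_finite by (cases c; cases s; cases t; auto)
        then show ?thesis by (simp add: add.assoc)
      qed
      consider "s \<in> {0..c}" "t \<in> {0..c}" | "s \<in> {c..len M e}" "t \<in> {c..len M e}"
        | "s \<in> {0..c}" "t \<in> {c..len M e}" | "s \<in> {c..len M e}" "t \<in> {0..c}"
        using s t by blast
      then show ?thesis
      proof cases
        case 1
        then show ?thesis using first[OF IH] True by simp
      next
        case 2
        then show ?thesis using second[OF IH] True by simp
      next
        case 3
        then show ?thesis using second[OF first[OF IH 3(1) mid(1)] mid(2) 3(2)] via True by simp
      next
        case 4
        then show ?thesis using first[OF second[OF IH 4(1) mid(2)] mid(1) 4(2)] via True by simp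
      qed
    qed
  qed
qed

lemma openin_subdivision_iff:
  assumes "U \<subseteq> points \<Gamma>"
  shows "openin (tc_top \<Gamma>) U \<longleftrightarrow> (\<forall>f\<in>mE subdivision.
    openin (top_of_set {0..len subdivision f}) {t \<in> {0..len subdivision f}. chart subdivision f t \<in> U})"
proof -
  have "openin (tc_top \<Gamma>) U \<longleftrightarrow>
      openin (top_of_set {0..len M e}) {t \<in> {0..len M e}. chart M e t \<in> U} \<and>
      (\<forall>f\<in>mE M - {e}. openin (top_of_set {0..len M f}) {t \<in> {0..len M f}. chart M f t \<in> U})"
    using openin_iff[OF assms] e by blast
  then show ?thesis
    unfolding ball_subdivision_iff openin_interval_split[OF c] by simp
qed

lemma is_model_subdivision: "is_model \<Gamma> subdivision"
  unfolding is_model_def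
proof (intro conjI)
  show "multigraph (graph subdivision)" by (rule multigraph_subdivision)
  show "\<forall>f\<in>mE subdivision. 0 < len subdivision f"
    unfolding ball_subdivision_iff using c_bounds len_pos by (simp add: ereal_diff_gr0)
  show "\<forall>f\<in>mE subdivision. len subdivision f = \<infinity> \<longrightarrow>
      leaf_edge (graph subdivision) f \<and> leaf_end (graph subdivision) (chart subdivision f \<infinity>)"
    using infinite_edge_subdivision by blast
  show "\<forall>f\<in>mE subdivision. ends (graph subdivision) f =
      {#chart subdivision f 0, chart subdivision f (len subdivision f)#}"
    unfolding ball_subdivision_iff using ends_eq by (simp add: shift_cancel)
  show "\<forall>f\<in>mE subdivision. chart subdivision f ` {0..len subdivision f} = f"
  proof -
    have "(\<lambda>t. chart M e (c + t)) ` {0..len M e - c} = second_part"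
      unfolding second_part_def by (simp flip: shift_image image_image)
    then show ?thesis
      unfolding ball_subdivision_iff using chart_image by (simp flip: first_part_def)
  qed
  show "\<forall>f\<in>mE subdivision. inj_on (chart subdivision f) {0<..<len subdivision f}"
  proof -
    have "inj_on (chart M e) ((\<lambda>t. c + t) ` {0<..<len M e - c})" "inj_on (chart M e) {0<..<c}"
      using c_bounds unfolding shift_image
      by (auto intro!: inj_on_subset[OF chart_inj_interior[OF e]])
    moreover have "inj_on (\<lambda>t. c + t) {0<..<len M e - c}"
    proof (rule inj_onI)
      fix s t assume "c + s = c + t"
      then show "s = t" using c_finite by (cases c; cases s; cases t; auto)
    qed
    ultimately show ?thesis
      unfolding ball_subdivision_iff using comp_inj_on chart_inj_interior
      by (fastforce simp: comp_def)
  qed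
  show "\<forall>f\<in>mE subdivision. edge_interior subdivision f \<inter> mV subdivision = {}"
    unfolding ball_subdivision_iff
    using edge_interior_parts_subset edge_interior_disjoint_vertices edge_interiors_disjoint cut_interior e
    by (simp add: edge_interior_parts(3)) blast
  show "\<forall>f\<in>mE subdivision. \<forall>g\<in>mE subdivision. f \<noteq> g \<longrightarrow>
      edge_interior subdivision f \<inter> edge_interior subdivision g = {}"
  proof -
    have "edge_interior subdivision f \<inter> edge_interior M g = {}"
      if "f = first_part \<or> f = second_part" "g \<in> mE M" "g \<noteq> e" for f g
      using that edge_interior_parts_subset edge_interiors_disjoint[OF e, of g] by blast
    then show ?thesis
      unfolding ball_subdivision_iff using edge_interior_parts_subset(3) edge_interiors_disjoint
      by (simp add: edge_interior_parts(3)) blast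
  qed
  show "points \<Gamma> = mV subdivision \<union> \<Union> (mE subdivision)"
    using points_eq parts_union e cut_interior edge_interior_subset[OF e] by auto
  show "\<forall>U. U \<subseteq> points \<Gamma> \<longrightarrow> (openin (tc_top \<Gamma>) U \<longleftrightarrow> (\<forall>f\<in>mE subdivision.
    openin (top_of_set {0..len subdivision f}) {t \<in> {0..len subdivision f}. chart subdivision f t \<in> U}))"
    using openin_subdivision_iff by blast
  show "\<forall>x\<in>points \<Gamma>. \<forall>y\<in>points \<Gamma>. tc_dist \<Gamma> x y = Inf {r. path_length subdivision x y r}"
    using tc_dist_eq path_length_subdivision_iff by simp
qed

lemma loopless_model_subdivision: "loopless_model \<Gamma> subdivision"
proof
  show "is_model \<Gamma> subdivision" by (rule is_model_subdivision)
  have "{chart M e 0, chart M e (len M e)} \<subseteq> mV M" using chart_ends_in_vertices[OF e] .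
  then have ends: "chart M e 0 \<noteq> chart M e c" "chart M e (len M e) \<noteq> chart M e c"
    using cut_not_vertex by auto
  show "loopless (graph subdivision)"
    unfolding loopless_def ball_subdivision_iff
    using loopless ends unfolding loopless_def by (auto simp: add_eq_conv_ex)
qed

end

text \<open>Every finite set of points can be made part of the vertex set, one subdivision at a time.\<close>

lemma exists_subdivision:
  assumes "loopless_model \<Gamma> M" "finite F" "F \<subseteq> points \<Gamma>"
  obtains N where "loopless_model \<Gamma> N" "mV N = mV M \<union> F"
proof -
  have "\<exists>N. loopless_model \<Gamma> N \<and> mV N = mV M \<union> F"
    using assms(2,3)
  proof (induction F)
    case empty
    then show ?case using assms(1) by auto
  next
    case (insert x F)
    then obtain N where N: "loopless_model \<Gamma> N" "mV N = mV M \<union> F" by auto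
    interpret N: loopless_model \<Gamma> N by (rule N(1))
    show ?case
    proof (cases "x \<in> mV N")
      case True
      then show ?thesis using N by (intro exI[of _ N]) auto
    next
      case False
      then obtain e where "e \<in> mE N" "x \<in> edge_interior N e"
        using insert.prems N.points_off_vertices by blast
      then obtain c where "edge_subdivision \<Gamma> N e c" "x = chart N e c"
        using N(1) unfolding edge_interior_def edge_subdivision_def edge_subdivision_axioms_def by blast
      then show ?thesis
        using edge_subdivision.loopless_model_subdivision edge_subdivision.subdivision_simps(1) N(2)
        by (metis Un_insert_right)
    qed
  qed
  then show ?thesis using that by blast
qed

section \<open>Comparing models of one curve\<close>

text \<open>The interior of an edge of \<open>N\<close> is connected and avoids the vertices of \<open>M\<close>, so it lies in one
  component of their complement; the closures of the two are edges. Thus having more vertices is the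
  same as being a finer model.\<close>

lemma edge_of_refinement:
  assumes "loopless_model \<Gamma> M" "loopless_model \<Gamma> N" "mV M \<subseteq> mV N" "e \<in> mE N"
  obtains f where "f \<in> mE M" "edge_interior N e \<subseteq> edge_interior M f" "e \<subseteq> f"
proof -
  interpret M: loopless_model \<Gamma> M by fact
  interpret N: loopless_model \<Gamma> N by fact
  have "edge_interior N e \<inter> mV M = {}"
    using N.edge_interior_disjoint_vertices assms(3,4) by blast
  then obtain f where f: "f \<in> mE M" "edge_interior N e \<subseteq> edge_interior M f"
    using M.connectedin_off_vertices[OF N.connectedin_edge_interior] N.edge_interior_nonempty assms(4)
    by metis
  then have "e \<subseteq> f"
    using closure_of_mono[OF f(2)] N.closure_of_edge_interior[OF assms(4)]
      M.closure_of_edge_interior[OF f(1)] by metis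
  then show ?thesis using that f by blast
qed

lemma refined_edge_through:
  assumes "loopless_model \<Gamma> M" "loopless_model \<Gamma> N" "mV M \<subseteq> mV N"
    and "f \<in> mE M" "y \<in> f" "y \<notin> mV N"
  obtains e where "e \<in> mE N" "y \<in> edge_interior N e" "e \<subseteq> f"
proof -
  interpret M: loopless_model \<Gamma> M by fact
  interpret N: loopless_model \<Gamma> N by fact
  obtain e where e: "e \<in> mE N" "y \<in> edge_interior N e"
    using N.points_off_vertices M.edge_subset_points assms(4-6) by blast
  obtain g where g: "g \<in> mE M" "edge_interior N e \<subseteq> edge_interior M g" "e \<subseteq> g"
    using edge_of_refinement[OF assms(1-3) e(1)] .
  have "g = f" using M.interior_edge_unique[OF g(1) assms(4)] g(2) e(2) assms(5) by blast
  then show ?thesis using that e g by blast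
qed

lemma enclosing_edge_unique:
  assumes "loopless_model \<Gamma> M" "loopless_model \<Gamma> N" "mV M \<subseteq> mV N" "e \<in> mE N"
    and "f \<in> mE M" "e \<subseteq> f" "g \<in> mE M" "e \<subseteq> g"
  shows "f = g"
proof -
  interpret M: loopless_model \<Gamma> M by fact
  interpret N: loopless_model \<Gamma> N by fact
  obtain h where h: "h \<in> mE M" "edge_interior N e \<subseteq> edge_interior M h"
    using edge_of_refinement[OF assms(1-4)] by metis
  obtain y where "y \<in> edge_interior N e" using N.edge_interior_nonempty[OF assms(4)] by blast
  then have "y \<in> edge_interior M h" "y \<in> f" "y \<in> g"
    using h N.edge_interior_subset[OF assms(4)] assms(6,8) by auto
  then show ?thesis using M.interior_edge_unique h(1) assms(5,7) by metis
qed

section \<open>Distinct points have positive distance\<close>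

lemma path_length_nonneg: "path_length M x y r \<Longrightarrow> 0 \<le> r"
  by (induction rule: path_length.induct) auto

context loopless_model
begin

text \<open>A path from the vertex \<open>x\<close> that is shorter than every edge stays in the star of \<open>x\<close>: along each
  edge, it has moved away from \<open>x\<close> by at most its own length, so it cannot pass the other end.\<close>

lemma short_path_from_vertex:
  assumes "path_length M x z r" "x \<in> mV M" "r < \<epsilon>" "\<forall>f\<in>mE M. \<epsilon> \<le> len M f"
  shows "z = x \<or> (\<exists>f\<in>mE M. \<exists>t\<in>{0..len M f}. z = chart M f t \<and>
    (chart M f 0 = x \<and> t \<le> r \<or> chart M f (len M f) = x \<and> len M f - t \<le> r))"
  using assms
proof (induction rule: path_length.induct)
  case (empty x)
  then show ?case by simp
next
  case (segment x e s r t)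
  note st = segment.hyps(2-4)
  have r0: "0 \<le> r" by (rule path_length_nonneg[OF segment.hyps(1)])
  have r1: "r \<le> r + \<bar>s - t\<bar>" using add_left_mono[of 0 "\<bar>s - t\<bar>" r] by simp
  then have r2: "r < \<epsilon>" using segment.prems by simp
  have tail: "chart M e 0 = x \<and> t \<le> r + \<bar>s - t\<bar> \<or>
      chart M e (len M e) = x \<and> len M e - t \<le> r + \<bar>s - t\<bar>"
    if "chart M e 0 = x \<and> s \<le> r \<or> chart M e (len M e) = x \<and> len M e - s \<le> r"
  proof -
    have "t \<le> r + \<bar>s - t\<bar>" if "s \<le> r"
      using that st r0 by (cases s; cases t; cases r; auto)
    moreover have "len M e - t \<le> r + \<bar>s - t\<bar>" if "len M e - s \<le> r"
      using that st r0 by (cases s; cases t; cases r; cases "len M e"; auto)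
    ultimately show ?thesis using that by blast
  qed
  have near: "chart M e 0 = x \<and> s \<le> r \<or> chart M e (len M e) = x \<and> len M e - s \<le> r"
    if ne: "chart M e s \<noteq> x"
  proof -
    obtain f u where f: "f \<in> mE M" "u \<in> {0..len M f}" "chart M e s = chart M f u"
      and u: "chart M f 0 = x \<and> u \<le> r \<or> chart M f (len M f) = x \<and> len M f - u \<le> r"
      using segment.IH[OF segment.prems(1) r2 segment.prems(3)] ne by blast
    have "r < len M f" using r2 segment.prems(3) f(1) by (metis less_le_trans)
    then have "u \<noteq> 0" "u \<noteq> len M f" using u f(3) ne by auto
    then have "u \<in> {0<..<len M f}" using f(2) by auto
    then have "e = f \<and> s = u" using chart_eq_interior[OF f(1) st(1)] st(2) f(3) by metis
    then show ?thesis using u by simp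
  qed
  show ?case
  proof (cases "chart M e s = x")
    case False
    then show ?thesis using tail near st by blast
  next
    case True
    then have "s = 0 \<or> s = len M e"
      using chart_mem_interior[OF st(2)] edge_interior_disjoint_vertices[OF st(1)] segment.prems(1)
      by blast
    \<comment> \<open>A nonempty path through a point at infinity has infinite length.\<close>
    moreover have "\<bar>s\<bar> \<noteq> \<infinity>"
      using segment.prems(2) r0 by (cases s; cases t; cases r; cases \<epsilon>; auto)
    moreover from this have "s - s = 0" by (cases s) auto
    ultimately have "chart M e 0 = x \<and> s \<le> r \<or> chart M e (len M e) = x \<and> len M e - s \<le> r"
      using True r0 by metis
    then show ?thesis using tail st by blast
  qed
qed

lemma tc_dist_vertices_pos:
  assumes "x \<in> mV M" "y \<in> mV M" "x \<noteq> y"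
  shows "0 < tc_dist \<Gamma> x y"
proof -
  define \<epsilon> :: ereal where "\<epsilon> = Min (insert 1 (len M ` mE M))"
  have fin: "finite (insert 1 (len M ` mE M))" using finite_edges by simp
  have \<epsilon>: "\<epsilon> \<le> len M f" if "f \<in> mE M" for f
    unfolding \<epsilon>_def using that by (intro Min_le[OF fin]) auto
  have "0 < \<epsilon>" unfolding \<epsilon>_def using fin len_pos by (auto simp: Min_gr_iff)
  moreover have "\<epsilon> \<le> r" if r: "path_length M x y r" for r
  proof (rule ccontr)
    assume "\<not> \<epsilon> \<le> r"
    then have r\<epsilon>: "r < \<epsilon>" by simp
    obtain f t where f: "f \<in> mE M" "t \<in> {0..len M f}" "y = chart M f t"
      and t: "chart M f 0 = x \<and> t \<le> r \<or> chart M f (len M f) = x \<and> len M f - t \<le> r"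
      using short_path_from_vertex[OF r assms(1) r\<epsilon>] \<epsilon> assms(3) by blast
    have "r < len M f" using r\<epsilon> \<epsilon>[OF f(1)] by (rule less_le_trans)
    then have "t \<noteq> 0" "t \<noteq> len M f" using t f(3) assms(3) by auto
    then have "y \<in> edge_interior M f" using chart_mem_interior f(2,3) by blast
    then show False using edge_interior_disjoint_vertices[OF f(1)] assms(2) by blast
  qed
  then have "\<epsilon> \<le> tc_dist \<Gamma> x y"
    using tc_dist_eq assms points_eq by (auto intro!: Inf_greatest)
  ultimately show ?thesis by simp
qed

lemma tc_dist_refl: "x \<in> points \<Gamma> \<Longrightarrow> tc_dist \<Gamma> x x = 0"
  using tc_dist_eq path_length.empty[of M x] path_length_nonneg[of M x x]
  by (auto intro!: antisym Inf_lower Inf_greatest)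

text \<open>After a subdivision both points are vertices, and the distance is the same for all models.\<close>

lemma tc_dist_pos:
  assumes "x \<in> points \<Gamma>" "y \<in> points \<Gamma>" "x \<noteq> y"
  shows "0 < tc_dist \<Gamma> x y"
proof -
  obtain N where N: "loopless_model \<Gamma> N" "mV N = mV M \<union> {x, y}"
    using exists_subdivision[of \<Gamma> M "{x, y}"] loopless_model_axioms assms by auto
  then show ?thesis using loopless_model.tc_dist_vertices_pos[OF N(1)] assms(3) by simp
qed

lemma tc_dist_interior_finite:
  assumes "e \<in> mE M" "x \<in> edge_interior M e" "y \<in> edge_interior M e"
  shows "tc_dist \<Gamma> x y < \<infinity>"
proof -
  obtain s t where st: "x = chart M e s" "y = chart M e t" "s \<in> {0<..<len M e}" "t \<in> {0<..<len M e}"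
    using assms unfolding edge_interior_def by blast
  then have "path_length M x y (0 + \<bar>s - t\<bar>)"
    using path_length.segment[of M x e s 0 t] path_length.empty[of M x] assms(1) by (auto simp: less_imp_le)
  moreover have "x \<in> points \<Gamma>" "y \<in> points \<Gamma>"
    using assms edge_interior_subset edge_subset_points by blast+
  ultimately have "tc_dist \<Gamma> x y \<le> 0 + \<bar>s - t\<bar>"
    using tc_dist_eq by (auto intro: Inf_lower)
  also have "\<dots> < \<infinity>" using st(3,4) by (cases s; cases t; auto)
  finally show ?thesis .
qed

end


section \<open>Finite morphisms and subdivision\<close>

text \<open>The image of the interior of \<open>e\<close> is connected and avoids the vertices, so \<open>\<phi>\<close> maps \<open>e\<close> into one
  edge \<open>f\<close>. The two ends of \<open>e\<close> have different images, which are then both ends of \<open>f\<close>; as the image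
  of \<open>e\<close> is connected, it is all of the arc \<open>f\<close>.\<close>

lemma edge_onto_edge:
  assumes N: "loopless_model \<Gamma> N" and N': "loopless_model \<Gamma>' N'"
    and cont: "continuous_map (tc_top \<Gamma>) (tc_top \<Gamma>') \<phi>"
    and vert: "\<And>x. x \<in> points \<Gamma> \<Longrightarrow> \<phi> x \<in> mV N' \<longleftrightarrow> x \<in> mV N"
    and e: "e \<in> mE N" and inj: "inj_on \<phi> e"
  shows "\<phi> ` e \<in> mE N'"
proof -
  interpret N: loopless_model \<Gamma> N by fact
  interpret N': loopless_model \<Gamma>' N' by fact
  have "\<phi> ` edge_interior N e \<inter> mV N' = {}"
    using vert N.edge_interior_eq[OF e] N.edge_subset_points[OF e] by blast
  then obtain f where f: "f \<in> mE N'" "\<phi> ` edge_interior N e \<subseteq> edge_interior N' f"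
    using N'.connectedin_off_vertices N.edge_interior_nonempty[OF e]
      connectedin_continuous_map_image[OF cont N.connectedin_edge_interior[OF e]]
    by (metis image_is_empty)
  have "\<phi> ` e \<subseteq> tc_top \<Gamma>' closure_of (\<phi> ` edge_interior N e)"
    using continuous_map_image_closure_subset[OF cont] N.closure_of_edge_interior[OF e] by metis
  also have "\<dots> \<subseteq> f"
    using closure_of_mono[OF f(2), of "tc_top \<Gamma>'"] N'.closure_of_edge_interior[OF f(1)] by simp
  finally have sub: "\<phi> ` e \<subseteq> f" .
  define a b where "a = chart N e 0" and "b = chart N e (len N e)"
  have ab: "a \<in> e" "b \<in> e" "a \<in> mV N" "b \<in> mV N" "a \<noteq> b"
    using N.edge_Int_vertices[OF e] N.chart_ends_distinct[OF e] unfolding a_def b_def by auto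
  then have "\<phi> a \<noteq> \<phi> b" using inj by (meson inj_onD)
  moreover have "\<phi> a \<in> f \<inter> mV N'" "\<phi> b \<in> f \<inter> mV N'"
    using ab sub vert N.edge_subset_points[OF e] by auto
  ultimately have "f \<inter> mV N' = {\<phi> a, \<phi> b}"
    using N'.edge_Int_vertices[OF f(1)] by auto
  then have "f \<inter> mV N' \<subseteq> \<phi> ` e" using ab(1,2) by blast
  then have "\<phi> ` e = f"
    using N'.connectedin_between_ends[OF f(1) _ sub]
      connectedin_continuous_map_image[OF cont N.connectedin_edge[OF e]] by blast
  then show ?thesis using f(1) by simp
qed

locale finite_morphism_models =
  fixes \<Gamma> :: "'a tcurve" and \<Gamma>' :: "'b tcurve" and M M' d \<phi>
  assumes wrt: "finite_morphism_wrt \<Gamma> \<Gamma>' M M' d \<phi>"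
    and continuous: "continuous_map (tc_top \<Gamma>) (tc_top \<Gamma>') \<phi>"
begin

sublocale source: loopless_model \<Gamma> M
  using wrt unfolding finite_morphism_wrt_def by unfold_locales auto

sublocale target: loopless_model \<Gamma>' M'
  using wrt unfolding finite_morphism_wrt_def by unfold_locales auto

lemma
  shows vertex_image: "v \<in> mV M \<Longrightarrow> \<phi> v \<in> mV M'"
    and edge_image: "e \<in> mE M \<Longrightarrow> \<phi> ` e \<in> mE M'"
    and edge_degree_pos: "e \<in> mE M \<Longrightarrow> 0 < d e"
    and dilation: "\<lbrakk>e \<in> mE M; x \<in> e; y \<in> e\<rbrakk> \<Longrightarrow>
      tc_dist \<Gamma>' (\<phi> x) (\<phi> y) = ereal (real (d e)) * tc_dist \<Gamma> x y"
  using wrt unfolding finite_morphism_wrt_def by (elim conjE, blast)+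

lemma image_in_points: "x \<in> points \<Gamma> \<Longrightarrow> \<phi> x \<in> points \<Gamma>'"
  using continuous unfolding continuous_map_def by blast

text \<open>The map \<open>\<phi>\<close> multiplies distances on an edge by a positive factor, and different points have
  positive distance.\<close>

lemma inj_on_edge:
  assumes "e \<in> mE M" shows "inj_on \<phi> e"
proof (rule inj_onI, rule ccontr)
  fix x y assume xy: "x \<in> e" "y \<in> e" "\<phi> x = \<phi> y" "x \<noteq> y"
  then have "x \<in> points \<Gamma>" "y \<in> points \<Gamma>" using source.edge_subset_points[OF assms] by auto
  then have "0 < ereal (real (d e)) * tc_dist \<Gamma> x y"
    using source.tc_dist_pos xy(4) edge_degree_pos[OF assms] by (simp add: ereal_zero_less_0_iff)
  moreover have "tc_dist \<Gamma>' (\<phi> x) (\<phi> y) = 0"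
    using target.tc_dist_refl image_in_points \<open>y \<in> points \<Gamma>\<close> xy(3) by simp
  ultimately show False using dilation[OF assms xy(1,2)] by (metis less_irrefl)
qed

text \<open>The two ends of an edge go to two different ends of its image, which has no others. By injectivity
  an interior point cannot go to a vertex.\<close>

lemma vertex_iff:
  assumes "x \<in> points \<Gamma>" shows "\<phi> x \<in> mV M' \<longleftrightarrow> x \<in> mV M"
proof
  assume x: "\<phi> x \<in> mV M'"
  show "x \<in> mV M"
  proof (rule ccontr)
    assume "x \<notin> mV M"
    then obtain e where e: "e \<in> mE M" "x \<in> e" using assms source.points_eq by auto
    define a b where "a = chart M e 0" and "b = chart M e (len M e)"
    have ab: "a \<in> e" "b \<in> e" "a \<in> mV M" "b \<in> mV M" "a \<noteq> b"
      using source.edge_Int_vertices[OF e(1)] source.chart_ends_distinct[OF e(1)]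
      unfolding a_def b_def by auto
    have "\<phi> a \<noteq> \<phi> b" using inj_on_edge[OF e(1)] ab by (meson inj_onD)
    moreover have "{\<phi> a, \<phi> b, \<phi> x} \<subseteq> \<phi> ` e \<inter> mV M'"
      using ab e x vertex_image by auto
    ultimately have "\<phi> x = \<phi> a \<or> \<phi> x = \<phi> b"
      using target.edge_Int_vertices[OF edge_image[OF e(1)]] by auto
    then have "x = a \<or> x = b" using inj_on_edge[OF e(1)] ab e(2) by (meson inj_onD)
    then show False using ab \<open>x \<notin> mV M\<close> by blast
  qed
qed (rule vertex_image)

lemma finite_preimage:
  assumes "finite F" shows "finite {x \<in> points \<Gamma>. \<phi> x \<in> F}"
proof -
  have "finite {x \<in> e. \<phi> x \<in> F}" if "e \<in> mE M" for e
    by (rule inj_on_finite[of \<phi> _ F])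
       (auto intro: inj_on_subset[OF inj_on_edge[OF that]] simp: assms)
  then have "finite (mV M \<union> (\<Union>e\<in>mE M. {x \<in> e. \<phi> x \<in> F}))"
    using source.finite_vertices source.finite_edges by blast
  then show ?thesis by (rule rev_finite_subset) (use source.points_eq in auto)
qed

text \<open>Harmonicity at the interior points of edges is automatic, because only one edge contains the image
  of such a point. It has to be recorded because a subdivision makes vertices of these points.\<close>

lemma local_degree_constant:
  assumes "harmonic_wrt M M' d \<phi>" "v \<in> points \<Gamma>"
    and "e' \<in> mE M'" "f' \<in> mE M'" "\<phi> v \<in> e'" "\<phi> v \<in> f'"
  shows "local_degree M d \<phi> v e' = local_degree M d \<phi> v f'"
proof (cases "v \<in> mV M")
  case True
  then show ?thesis
    using assms target.incident_iff vertex_image unfolding harmonic_wrt_def by blast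
next
  case False
  then have "\<phi> v \<notin> mV M'" using vertex_iff assms(2) by blast
  then have "\<phi> v \<in> edge_interior M' e'" using target.edge_interior_eq assms(3,5) by blast
  then have "f' = e'" using target.interior_edge_unique assms(3,4,6) by blast
  then show ?thesis by simp
qed

end

definition enclosing_edge :: "'a tmodel \<Rightarrow> 'a set \<Rightarrow> 'a set" where
  "enclosing_edge M e = (SOME f. f \<in> mE M \<and> e \<subseteq> f)"

lemma enclosing_edge:
  assumes "loopless_model \<Gamma> M" "loopless_model \<Gamma> N" "mV M \<subseteq> mV N" "e \<in> mE N"
  shows "enclosing_edge M e \<in> mE M" "e \<subseteq> enclosing_edge M e"
  unfolding enclosing_edge_def
  using someI_ex[of "\<lambda>f. f \<in> mE M \<and> e \<subseteq> f"] edge_of_refinement[OF assms] by metis+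

text \<open>Subdividing the target at arbitrary points forces the vertices of the source: by
  \<open>vertex_iff\<close> they are the preimage of the vertices of the target.\<close>

locale subdivided_morphism = finite_morphism_models +
  fixes N :: "'a tmodel" and N' :: "'b tmodel"
  assumes N: "loopless_model \<Gamma> N" and N': "loopless_model \<Gamma>' N'"
    and vertices': "mV M' \<subseteq> mV N'" and vertices: "mV N = {x \<in> points \<Gamma>. \<phi> x \<in> mV N'}"
begin

definition refined_degree :: "'a set \<Rightarrow> nat" where
  "refined_degree e = d (enclosing_edge M e)"

lemma vertices_subset: "mV M \<subseteq> mV N"
  using vertices vertices' vertex_image source.points_eq by auto

lemmas enclosing = enclosing_edge[OF source.loopless_model_axioms N vertices_subset]

lemma refined_edge_image:
  assumes "e \<in> mE N" shows "\<phi> ` e \<in> mE N'"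
  using edge_onto_edge[OF N N' continuous _ assms] vertices
    inj_on_subset[OF inj_on_edge[OF enclosing(1)[OF assms]] enclosing(2)[OF assms]] by simp

lemma refined: "finite_morphism_models \<Gamma> \<Gamma>' N N' refined_degree \<phi>"
proof
  interpret N: loopless_model \<Gamma> N by (rule N)
  interpret N': loopless_model \<Gamma>' N' by (rule N')
  have "tc_dist \<Gamma>' (\<phi> x) (\<phi> y) = ereal (real (refined_degree e)) * tc_dist \<Gamma> x y"
    if "e \<in> mE N" "x \<in> e" "y \<in> e" for e x y
    unfolding refined_degree_def
    using that enclosing by (intro dilation) auto
  then show "finite_morphism_wrt \<Gamma> \<Gamma>' N N' refined_degree \<phi>"
    unfolding finite_morphism_wrt_def
    using N.is_model N'.is_model N.loopless N'.loopless vertices refined_edge_image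
      edge_degree_pos enclosing(1) by (auto simp: refined_degree_def)
  show "continuous_map (tc_top \<Gamma>) (tc_top \<Gamma>') \<phi>" by (rule continuous)
qed

lemma refined_edge_over:
  assumes f: "f \<in> mE M" and e': "e' \<in> mE N'" "e' \<subseteq> \<phi> ` f"
  obtains e where "e \<in> mE N" "e \<subseteq> f" "\<phi> ` e = e'"
proof -
  interpret N: loopless_model \<Gamma> N by (rule N)
  interpret N': loopless_model \<Gamma>' N' by (rule N')
  obtain y' where y': "y' \<in> edge_interior N' e'"
    using N'.edge_interior_nonempty[OF e'(1)] by blast
  then obtain y where y: "y \<in> f" "\<phi> y = y'"
    using N'.edge_interior_subset[OF e'(1)] e'(2) by blast
  have "y \<notin> mV N"
    using vertices y(2) y' N'.edge_interior_disjoint_vertices[OF e'(1)] by blast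
  then obtain e where e: "e \<in> mE N" "y \<in> edge_interior N e" "e \<subseteq> f"
    using refined_edge_through[OF source.loopless_model_axioms N vertices_subset f y(1)] by blast
  have "y' \<in> \<phi> ` e" using y(2) e(2) N.edge_interior_subset[OF e(1)] by blast
  then have "\<phi> ` e = e'"
    using N'.interior_edge_unique[OF e'(1) refined_edge_image[OF e(1)] y'] by simp
  then show ?thesis using that e by blast
qed

text \<open>As \<open>\<phi>\<close> maps each edge \<open>f\<close> over \<open>f'\<close> bijectively onto \<open>f'\<close>, exactly one part of \<open>f\<close> lies over
  \<open>e'\<close>, and it contains \<open>v\<close> if and only if \<open>f\<close> does. So both sides are sums over the same edges \<open>f\<close>.\<close>

lemma local_degree_refined:
  assumes f': "f' \<in> mE M'" and e': "e' \<in> mE N'" "e' \<subseteq> f'" and v: "\<phi> v \<in> e'"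
  shows "local_degree N refined_degree \<phi> v e' = local_degree M d \<phi> v f'"
proof -
  interpret N: loopless_model \<Gamma> N by (rule N)
  interpret N': loopless_model \<Gamma>' N' by (rule N')
  let ?A = "{e \<in> mE N. \<phi> ` e = e' \<and> v \<in> e}" and ?B = "{f \<in> mE M. \<phi> ` f = f' \<and> v \<in> f}"
  have "inj_on (enclosing_edge M) ?A"
  proof (rule inj_onI)
    fix e1 e2
    assume e: "e1 \<in> ?A" "e2 \<in> ?A" and eq: "enclosing_edge M e1 = enclosing_edge M e2"
    obtain y' where y': "y' \<in> edge_interior N' e'"
      using N'.edge_interior_nonempty[OF e'(1)] by blast
    then have "y' \<in> \<phi> ` e1" "y' \<in> \<phi> ` e2"
      using e N'.edge_interior_subset[OF e'(1)] by auto
    then obtain y1 y2 where y: "y1 \<in> e1" "\<phi> y1 = y'" "y2 \<in> e2" "\<phi> y2 = y'"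
      by (auto elim!: imageE)
    have enc: "e1 \<subseteq> enclosing_edge M e1" "e2 \<subseteq> enclosing_edge M e1"
      "enclosing_edge M e1 \<in> mE M"
      using enclosing e eq by auto
    have "y1 = y2"
      by (rule inj_onD[OF inj_on_edge[OF enc(3)]]) (use y enc in auto)
    moreover have "y1 \<notin> mV N"
      using vertices y(2) y' N'.edge_interior_disjoint_vertices[OF e'(1)] by blast
    ultimately have "y1 \<in> edge_interior N e1" "y1 \<in> e2"
      using N.edge_interior_eq e y by auto
    then show "e1 = e2" using N.interior_edge_unique e by blast
  qed
  moreover have "enclosing_edge M ` ?A = ?B"
  proof (intro equalityI subsetI)
    fix f assume "f \<in> enclosing_edge M ` ?A"
    then obtain e where e: "e \<in> ?A" "f = enclosing_edge M e" by blast
    then have f: "f \<in> mE M" "e \<subseteq> f" using enclosing by auto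
    then have "\<phi> ` f = f'"
      using enclosing_edge_unique[OF target.loopless_model_axioms N' vertices' e'(1)
          edge_image[OF f(1)] _ f' e'(2)] e by blast
    then show "f \<in> ?B" using f e by blast
  next
    fix f assume f: "f \<in> ?B"
    then obtain e where e: "e \<in> mE N" "e \<subseteq> f" "\<phi> ` e = e'"
      using refined_edge_over[of f e'] e' by blast
    then obtain u where u: "u \<in> e" "\<phi> u = \<phi> v" using v by (metis imageE)
    then have "u = v" using inj_on_edge f e(2) by (metis (no_types, lifting) inj_onD mem_Collect_eq subsetD)
    then have "e \<in> ?A" using e u by blast
    moreover have "enclosing_edge M e = f"
      using enclosing_edge_unique[OF source.loopless_model_axioms N vertices_subset e(1)
          enclosing[OF e(1)] _ e(2)] f by blast
    ultimately show "f \<in> enclosing_edge M ` ?A" by blast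
  qed
  ultimately have "bij_betw (enclosing_edge M) ?A ?B" by (simp add: bij_betw_def)
  then show ?thesis
    unfolding local_degree_def refined_degree_def by (rule sum.reindex_bij_betw)
qed

lemma harmonic_refined:
  assumes "harmonic_wrt M M' d \<phi>" shows "harmonic_wrt N N' refined_degree \<phi>"
  unfolding harmonic_wrt_def
proof (intro ballI impI)
  interpret N': loopless_model \<Gamma>' N' by (rule N')
  fix v e1 e2
  assume v: "v \<in> mV N" and e: "e1 \<in> mE N'" "e2 \<in> mE N'"
    and "\<phi> v \<in># ends (graph N') e1" "\<phi> v \<in># ends (graph N') e2"
  then have ve: "\<phi> v \<in> e1" "\<phi> v \<in> e2" using N'.incident_iff by auto
  obtain f1 f2 where f: "f1 \<in> mE M'" "e1 \<subseteq> f1" "f2 \<in> mE M'" "e2 \<subseteq> f2"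
    using edge_of_refinement[OF target.loopless_model_axioms N' vertices'] e by metis
  have "local_degree M d \<phi> v f1 = local_degree M d \<phi> v f2"
    using local_degree_constant[OF assms _ f(1,3)] v vertices ve f(2,4) by blast
  then show "local_degree N refined_degree \<phi> v e1 = local_degree N refined_degree \<phi> v e2"
    using local_degree_refined f e ve by metis
qed

end

section \<open>A Galois covering has degree one on every edge\<close>

context finite_morphism_models
begin

text \<open>Double counting: each edge over \<open>e'\<close> has exactly one end over the end \<open>v'\<close> of \<open>e'\<close>. So the
  degree of \<open>\<phi>\<close> is the sum of the edge degrees over any edge \<open>e'\<close>.\<close>

lemma sum_vertex_degree:
  assumes harmonic: "harmonic_wrt M M' d \<phi>" and e': "e' \<in> mE M'" and v': "v' \<in> e'" "v' \<in> mV M'"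
  shows "(\<Sum>v\<in>{v \<in> mV M. \<phi> v = v'}. vertex_degree M M' d \<phi> v) = (\<Sum>e\<in>{e \<in> mE M. \<phi> ` e = e'}. d e)"
proof -
  let ?V = "{v \<in> mV M. \<phi> v = v'}" and ?E = "{e \<in> mE M. \<phi> ` e = e'}"
  have fin: "finite ?V" "finite ?E" using source.finite_vertices source.finite_edges by auto
  have "vertex_degree M M' d \<phi> v = (\<Sum>e\<in>?E. if v \<in> e then d e else 0)" if v: "v \<in> ?V" for v
  proof -
    have "vertex_degree M M' d \<phi> v = local_degree M d \<phi> v e'"
      unfolding vertex_degree_def
    proof (rule the_equality)
      show "\<forall>f'\<in>mE M'. \<phi> v \<in># ends (graph M') f' \<longrightarrow> local_degree M d \<phi> v f' = local_degree M d \<phi> v e'"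
        using harmonic v v' e' target.incident_iff unfolding harmonic_wrt_def by blast
    next
      fix n assume "\<forall>f'\<in>mE M'. \<phi> v \<in># ends (graph M') f' \<longrightarrow> local_degree M d \<phi> v f' = n"
      then show "n = local_degree M d \<phi> v e'"
        using v v' e' target.incident_iff[OF e'] by blast
    qed
    also have "\<dots> = (\<Sum>e\<in>{e \<in> ?E. v \<in> e}. d e)"
      unfolding local_degree_def by (rule sum.cong) auto
    also have "\<dots> = (\<Sum>e\<in>?E. if v \<in> e then d e else 0)"
      by (rule sum.inter_filter[OF fin(2)])
    finally show ?thesis .
  qed
  then have "(\<Sum>v\<in>?V. vertex_degree M M' d \<phi> v) = (\<Sum>v\<in>?V. \<Sum>e\<in>?E. if v \<in> e then d e else 0)"
    by (rule sum.cong[OF refl])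
  also have "\<dots> = (\<Sum>e\<in>?E. \<Sum>v\<in>?V. if v \<in> e then d e else 0)" by (rule sum.swap)
  also have "\<dots> = (\<Sum>e\<in>?E. d e)"
  proof (rule sum.cong[OF refl])
    fix e assume e: "e \<in> ?E"
    then have "v' \<in> \<phi> ` e" using v'(1) by simp
    then obtain u where u: "u \<in> e" "\<phi> u = v'" by blast
    moreover have "u \<in> mV M"
      using vertex_iff[of u] u e v'(2) source.edge_subset_points by blast
    moreover have "v = u" if "v \<in> e" "\<phi> v = v'" for v
      using inj_onD[OF inj_on_edge[of e]] that u e by auto
    ultimately have "{v \<in> ?V. v \<in> e} = {u}" by blast
    then show "(\<Sum>v\<in>?V. if v \<in> e then d e else 0) = d e"
      using sum.inter_filter[OF fin(1), of "\<lambda>_. d e" "\<lambda>v. v \<in> e"] by simp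
  qed
  finally show ?thesis .
qed

text \<open>A point over \<open>y\<close> is not a vertex, and it is determined by the edge over \<open>e'\<close> in which it lies.\<close>

lemma card_generic_fiber_le:
  assumes e': "e' \<in> mE M'" and y: "y \<in> edge_interior M' e'"
  shows "finite (fiber \<Gamma> \<phi> y) \<and> card (fiber \<Gamma> \<phi> y) \<le> card {e \<in> mE M. \<phi> ` e = e'}"
proof -
  let ?E = "{e \<in> mE M. \<phi> ` e = e'}" and ?p = "\<lambda>e. SOME x. x \<in> e \<and> \<phi> x = y"
  have sub: "fiber \<Gamma> \<phi> y \<subseteq> ?p ` ?E"
  proof
    fix x assume "x \<in> fiber \<Gamma> \<phi> y"
    then have x: "x \<in> points \<Gamma>" "\<phi> x = y" unfolding fiber_def by auto
    then have "x \<notin> mV M"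
      using vertex_image y target.edge_interior_disjoint_vertices[OF e'] by blast
    then obtain e where e: "e \<in> mE M" "x \<in> e" using x source.points_eq by auto
    then have "\<phi> ` e = e'"
      using target.interior_edge_unique[OF e' edge_image[OF e(1)] y] x by auto
    moreover have "?p e = x"
      by (rule some_equality) (use e x inj_onD[OF inj_on_edge[OF e(1)]] in auto)
    ultimately show "x \<in> ?p ` ?E" using e(1) by force
  qed
  have fin: "finite ?E" using source.finite_edges by simp
  note finite_subset[OF sub finite_imageI[OF fin]]
  moreover note le_trans[OF card_mono[OF finite_imageI[OF fin] sub] card_image_le[OF fin]]
  ultimately show ?thesis by (rule conjI)
qed

end

text \<open>The orbit of a point with trivial stabilizer has as many elements as \<open>G\<close>.\<close>

lemma card_fiber_ge_order:
  assumes "transitive_action G (fiber \<Gamma> \<phi> x') (\<lambda>g. restrict (act g) (fiber \<Gamma> \<phi> x'))"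
    and "x \<in> fiber \<Gamma> \<phi> x'" "stabilizer G act x = {\<one>\<^bsub>G\<^esub>}" "finite (fiber \<Gamma> \<phi> x')"
  shows "order G \<le> card (fiber \<Gamma> \<phi> x')"
proof -
  let ?F = "fiber \<Gamma> \<phi> x'" and ?a = "\<lambda>g. restrict (act g) (fiber \<Gamma> \<phi> x')"
  interpret transitive_action G ?F ?a by (rule assms(1))
  have "stabilizer G ?a x = {\<one>\<^bsub>G\<^esub>}"
    using assms(2,3) unfolding stabilizer_def by simp
  then have "order G = card (orbit G ?a x)"
    using orbit_stabilizer_theorem[OF assms(2)] by simp
  also have "\<dots> \<le> card ?F"
    using element_image assms(2) by (intro card_mono[OF assms(4)]) (auto simp: orbit_def)
  finally show ?thesis .
qed

lemma sum_pos_nat_le_card_imp_one: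
  fixes f :: "'a \<Rightarrow> nat"
  assumes "finite A" "\<And>x. x \<in> A \<Longrightarrow> 0 < f x" "sum f A \<le> card A" "x \<in> A"
  shows "f x = 1"
proof (rule ccontr)
  assume "f x \<noteq> 1"
  then have "1 < f x" using assms(2)[OF assms(4)] by simp
  then have "(\<Sum>x\<in>A. 1) < sum f A"
    using assms(2,4) by (intro sum_strict_mono_ex1[OF assms(1)]) (auto simp: Suc_le_eq)
  then show False using assms(3) by simp
qed

text \<open>Let \<open>y\<close> be an interior point of an edge \<open>e'\<close> over which all stabilizers are trivial. Then the
  fiber of \<open>y\<close> has at least \<open>|G|\<close> points, so there are at least \<open>|G|\<close> edges over \<open>e'\<close>. Their degrees
  are positive with sum \<open>|G|\<close>, so all of them are one. As \<open>|G|\<close> is positive, no edge and no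
  vertex of the target is missed.\<close>

lemma galois_covering_models:
  assumes G: "group G" "finite (carrier G)" and galois: "galois_covering G act \<Gamma> \<Gamma>' \<phi>"
  obtains M M' d where "finite_morphism_models \<Gamma> \<Gamma>' M M' d \<phi>" "harmonic_wrt M M' d \<phi>"
    and "\<forall>e\<in>mE M. d e = 1" "\<forall>e'\<in>mE M'. \<exists>e\<in>mE M. \<phi> ` e = e'" "\<phi> ` points \<Gamma> = points \<Gamma>'"
proof -
  have harmonic: "finite_harmonic_morphism \<Gamma> \<Gamma>' \<phi>" and degree: "has_degree \<Gamma> \<Gamma>' \<phi> (order G)"
    and trans: "\<And>x'. x' \<in> points \<Gamma>' \<Longrightarrow>
      transitive_action G (fiber \<Gamma> \<phi> x') (\<lambda>g. restrict (act g) (fiber \<Gamma> \<phi> x'))"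
    and stab: "finite {x \<in> points \<Gamma>. stabilizer G act x \<noteq> {\<one>\<^bsub>G\<^esub>}}"
    using galois unfolding galois_covering_def by blast+
  have cont: "continuous_map (tc_top \<Gamma>) (tc_top \<Gamma>') \<phi>"
    using harmonic unfolding finite_harmonic_morphism_def finite_morphism_def by blast
  have order: "0 < order G"
    using G group.is_monoid monoid.one_closed by (auto simp: order_def card_gt_0_iff)
  from degree consider
    (point) "is_singleton (points \<Gamma>)" "is_singleton (points \<Gamma>')"
  | (curve) "\<exists>M M' d. finite_morphism_wrt \<Gamma> \<Gamma>' M M' d \<phi> \<and> harmonic_wrt M M' d \<phi> \<and>
         (\<forall>v'\<in>mV M'. (\<Sum>v\<in>{v \<in> mV M. \<phi> v = v'}. vertex_degree M M' d \<phi> v) = order G)"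
    unfolding has_degree_def by blast
  then show ?thesis
  proof cases
    \<comment> \<open>Every number is a degree here, so nothing can be counted, but there are no edges.\<close>
    case point
    obtain M M' d where M: "finite_morphism_wrt \<Gamma> \<Gamma>' M M' d \<phi>" "harmonic_wrt M M' d \<phi>"
      using harmonic unfolding finite_harmonic_morphism_def by blast
    interpret finite_morphism_models \<Gamma> \<Gamma>' M M' d \<phi> by unfold_locales (fact M cont)+
    obtain p q where pq: "points \<Gamma> = {p}" "points \<Gamma>' = {q}"
      using point unfolding is_singleton_def by blast
    have "mE M' = {}"
    proof (rule ccontr)
      assume "mE M' \<noteq> {}"
      then obtain e' where e': "e' \<in> mE M'" by blast
      then have "edge_interior M' e' \<subseteq> {q}"
        using target.edge_interior_subset target.edge_subset_points pq by blast
      then show False using target.infinite_edge_interior[OF e'] finite_subset by blast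
    qed
    moreover from this have "mE M = {}" using edge_image by blast
    moreover have "\<phi> ` points \<Gamma> = points \<Gamma>'" using pq image_in_points by auto
    ultimately show ?thesis
      using that[of M M' d] finite_morphism_models_axioms M(2) by simp
  next
    case curve
    then obtain M M' d where M: "finite_morphism_wrt \<Gamma> \<Gamma>' M M' d \<phi>" "harmonic_wrt M M' d \<phi>"
      and deg: "\<And>v'. v' \<in> mV M' \<Longrightarrow>
        (\<Sum>v\<in>{v \<in> mV M. \<phi> v = v'}. vertex_degree M M' d \<phi> v) = order G"
      by blast
    interpret finite_morphism_models \<Gamma> \<Gamma>' M M' d \<phi> by unfold_locales (fact M cont)+
    have sum: "(\<Sum>e\<in>{e \<in> mE M. \<phi> ` e = e'}. d e) = order G" if e': "e' \<in> mE M'" for e'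
    proof -
      have "chart M' e' 0 \<in> e'" "chart M' e' 0 \<in> mV M'" using target.edge_Int_vertices[OF e'] by auto
      then show ?thesis using sum_vertex_degree[OF M(2) e', of "chart M' e' 0"] deg by simp
    qed
    have hit: "\<exists>e\<in>mE M. \<phi> ` e = e'" if "e' \<in> mE M'" for e'
    proof (rule ccontr)
      assume "\<not> (\<exists>e\<in>mE M. \<phi> ` e = e')"
      then have "{e \<in> mE M. \<phi> ` e = e'} = {}" by blast
      then show False using sum[OF that] order by (metis less_irrefl sum.empty)
    qed
    have one: "d e = 1" if e: "e \<in> mE M" for e
    proof -
      let ?E = "{f \<in> mE M. \<phi> ` f = \<phi> ` e}"
      note e' = edge_image[OF e]
      obtain y where y: "y \<in> edge_interior M' (\<phi> ` e)"
        "y \<notin> \<phi> ` {x \<in> points \<Gamma>. stabilizer G act x \<noteq> {\<one>\<^bsub>G\<^esub>}}"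
        using target.infinite_edge_interior[OF e'] stab
        by (meson finite_imageI finite_subset subsetI)
      then obtain x where "x \<in> e" "\<phi> x = y"
        using target.edge_interior_subset[OF e'] by blast
      moreover have "x \<in> points \<Gamma>" using \<open>x \<in> e\<close> source.edge_subset_points[OF e] by blast
      ultimately have x: "x \<in> fiber \<Gamma> \<phi> y" "stabilizer G act x = {\<one>\<^bsub>G\<^esub>}" "y \<in> points \<Gamma>'"
        using y(2) image_in_points unfolding fiber_def by auto
      have "order G \<le> card (fiber \<Gamma> \<phi> y)"
        using card_fiber_ge_order[of G \<Gamma> \<phi> y act x] trans x card_generic_fiber_le[OF e' y(1)] by blast
      then have "sum d ?E \<le> card ?E"
        using card_generic_fiber_le[OF e' y(1)] sum[OF e'] by simp
      then show ?thesis
        using sum_pos_nat_le_card_imp_one[of ?E d e] edge_degree_pos source.finite_edges e by simp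
    qed
    have "points \<Gamma>' \<subseteq> \<phi> ` points \<Gamma>"
    proof
      fix y assume y: "y \<in> points \<Gamma>'"
      show "y \<in> \<phi> ` points \<Gamma>"
      proof (cases "y \<in> mV M'")
        case True
        have "{v \<in> mV M. \<phi> v = y} \<noteq> {}"
          using deg[OF True] order by (metis less_irrefl sum.empty)
        then show ?thesis using source.points_eq by blast
      next
        case False
        then obtain e' where "e' \<in> mE M'" "y \<in> e'" using y target.points_eq by auto
        then show ?thesis using hit source.edge_subset_points by blast
      qed
    qed
    then have "\<phi> ` points \<Gamma> = points \<Gamma>'" using image_in_points by blast
    then show ?thesis
      using that[of M M' d] finite_morphism_models_axioms M(2) one hit by blast
  qed
qed


section \<open>Descent along a covering of local degree one\<close>

text \<open>There are finitely many edges, and on each of them \<open>\<phi>\<close> is a continuous map from a compact space to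
  a Hausdorff space.\<close>

lemma (in finite_morphism_models) closed_map: "closed_map (tc_top \<Gamma>) (tc_top \<Gamma>') \<phi>"
  unfolding closed_map_def
proof (intro allI impI)
  fix C assume C: "closedin (tc_top \<Gamma>) C"
  have "closedin (tc_top \<Gamma>') (\<phi> ` (C \<inter> e))" if e: "e \<in> mE M" for e
  proof -
    have "closed_map (subtopology (tc_top \<Gamma>) e) (subtopology (tc_top \<Gamma>') (\<phi> ` e)) \<phi>"
      by (intro continuous_imp_closed_map continuous_map_into_subtopology
          continuous_map_from_subtopology[OF continuous] compact_space_subtopology source.compactin_edge[OF e]
          target.Hausdorff_space_edge[OF edge_image[OF e]]) (auto simp: topspace_subtopology)
    moreover have "closedin (subtopology (tc_top \<Gamma>) e) (C \<inter> e)"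
      using closedin_subtopology_Int_closed[OF C, of e] by (metis Int_commute)
    ultimately have "closedin (subtopology (tc_top \<Gamma>') (\<phi> ` e)) (\<phi> ` (C \<inter> e))"
      unfolding closed_map_def by blast
    then show ?thesis using closedin_trans_full target.closedin_edge[OF edge_image[OF e]] by blast
  qed
  then have "closedin (tc_top \<Gamma>') (\<Union>e\<in>mE M. \<phi> ` (C \<inter> e))"
    using source.finite_edges by (intro closedin_Union) auto
  moreover have "closedin (tc_top \<Gamma>') (\<phi> ` (C \<inter> mV M))"
    using source.finite_vertices vertex_image target.points_eq
    by (intro target.closedin_finite) auto
  ultimately have "closedin (tc_top \<Gamma>') ((\<Union>e\<in>mE M. \<phi> ` (C \<inter> e)) \<union> \<phi> ` (C \<inter> mV M))"
    by (rule closedin_Un)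
  also have "(\<Union>e\<in>mE M. \<phi> ` (C \<inter> e)) \<union> \<phi> ` (C \<inter> mV M) = \<phi> ` C"
  proof -
    have "C = (\<Union>e\<in>mE M. C \<inter> e) \<union> (C \<inter> mV M)"
      using closedin_subset[OF C] source.points_eq by auto
    then show ?thesis by (metis image_Un image_UN)
  qed
  finally show "closedin (tc_top \<Gamma>') (\<phi> ` C)" .
qed

text \<open>Here \<open>\<phi>\<close> and \<open>\<psi>\<close> are described by the same model \<open>M\<close> of the source, and \<open>\<phi>\<close> is isometric on each
  edge. Since every edge of \<open>M'\<close> is the image of an edge of \<open>M\<close>, the properties of \<open>\<psi>\<close> can be read off
  for \<open>\<theta>\<close> edge by edge.\<close>

locale descent =
  phi: finite_morphism_models \<Gamma> \<Gamma>' M M' \<delta> \<phi> + psi: finite_morphism_models \<Gamma> \<Gamma>'' M M'' d \<psi>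
  for \<Gamma> :: "'a tcurve" and \<Gamma>' :: "'b tcurve" and \<Gamma>'' :: "'c tcurve" and M M' M'' \<delta> d \<phi> \<psi> +
  fixes \<theta> :: "'b \<Rightarrow> 'c"
  assumes phi_harmonic: "harmonic_wrt M M' \<delta> \<phi>" and psi_harmonic: "harmonic_wrt M M'' d \<psi>"
    and degree_one: "\<And>e. e \<in> mE M \<Longrightarrow> \<delta> e = 1"
    and edges_hit: "\<And>e'. e' \<in> mE M' \<Longrightarrow> \<exists>e\<in>mE M. \<phi> ` e = e'"
    and surjective: "\<phi> ` points \<Gamma> = points \<Gamma>'"
    and factors: "\<And>x. x \<in> points \<Gamma> \<Longrightarrow> \<psi> x = \<theta> (\<phi> x)"
begin

lemma continuous_descent: "continuous_map (tc_top \<Gamma>') (tc_top \<Gamma>'') \<theta>"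
proof (rule continuous_compose_quotient_map)
  show "quotient_map (tc_top \<Gamma>) (tc_top \<Gamma>') \<phi>"
    by (rule continuous_closed_imp_quotient_map[OF phi.continuous phi.closed_map surjective])
  show "continuous_map (tc_top \<Gamma>) (tc_top \<Gamma>'') (\<theta> \<circ> \<phi>)"
    using continuous_map_eq[OF psi.continuous] factors by (metis comp_apply)
qed

definition lift :: "'b set \<Rightarrow> 'a set" where
  "lift e' = (SOME e. e \<in> mE M \<and> \<phi> ` e = e')"

definition descent_degree :: "'b set \<Rightarrow> nat" where
  "descent_degree e' = d (lift e')"

lemma lift:
  assumes "e' \<in> mE M'" shows "lift e' \<in> mE M" "\<phi> ` lift e' = e'"
  using someI_ex[of "\<lambda>e. e \<in> mE M \<and> \<phi> ` e = e'"] edges_hit[OF assms] unfolding lift_def by blast+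

lemma descent_image: "e \<in> mE M \<Longrightarrow> \<theta> ` \<phi> ` e = \<psi> ` e"
  using factors phi.source.edge_subset_points by (force simp: image_image)

lemma descent_dilation:
  assumes e: "e \<in> mE M" and xy: "x \<in> \<phi> ` e" "y \<in> \<phi> ` e"
  shows "tc_dist \<Gamma>'' (\<theta> x) (\<theta> y) = ereal (real (d e)) * tc_dist \<Gamma>' x y"
proof -
  obtain u v where uv: "u \<in> e" "v \<in> e" "x = \<phi> u" "y = \<phi> v" using xy by blast
  then have "\<theta> x = \<psi> u" "\<theta> y = \<psi> v" using factors phi.source.edge_subset_points[OF e] by auto
  moreover have "tc_dist \<Gamma>' x y = tc_dist \<Gamma> u v"
    using phi.dilation[OF e uv(1,2)] degree_one[OF e] uv(3,4) by (simp flip: one_ereal_def)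
  ultimately show ?thesis using psi.dilation[OF e uv(1,2)] by simp
qed

text \<open>The factor does not depend on the chosen lift, because it can be recovered as the ratio of two
  distances in \<open>\<Gamma>''\<close> and \<open>\<Gamma>'\<close>. The points are taken in the interior of the edge so that their distance
  is finite.\<close>

lemma descent_degree_eq:
  assumes e: "e \<in> mE M" shows "descent_degree (\<phi> ` e) = d e"
proof -
  note e' = phi.edge_image[OF e]
  obtain x where x: "x \<in> edge_interior M' (\<phi> ` e)"
    using phi.target.edge_interior_nonempty[OF e'] by blast
  have "infinite (edge_interior M' (\<phi> ` e) - {x})"
    using phi.target.infinite_edge_interior[OF e'] by simp
  then obtain y where y: "y \<in> edge_interior M' (\<phi> ` e)" "y \<noteq> x"
    by (metis Diff_iff all_not_in_conv finite.emptyI singletonI)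
  have sub: "edge_interior M' (\<phi> ` e) \<subseteq> \<phi> ` e" by (rule phi.target.edge_interior_subset[OF e'])
  have xy: "x \<in> \<phi> ` e" "y \<in> \<phi> ` e" using x y sub by auto
  have "0 < tc_dist \<Gamma>' x y"
    using phi.target.tc_dist_pos[of x y] xy y(2) phi.target.edge_subset_points[OF e'] by blast
  moreover have "tc_dist \<Gamma>' x y < \<infinity>"
    using phi.target.tc_dist_interior_finite[OF e' x y(1)] .
  moreover have "ereal (real (d (lift (\<phi> ` e)))) * tc_dist \<Gamma>' x y = ereal (real (d e)) * tc_dist \<Gamma>' x y"
    using descent_dilation[OF e xy] descent_dilation[OF lift(1)[OF e'], of x y] lift(2)[OF e'] xy by simp
  ultimately show ?thesis
    unfolding descent_degree_def by (cases "tc_dist \<Gamma>' x y") auto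
qed

lemma finite_morphism_descent: "finite_morphism_wrt \<Gamma>' \<Gamma>'' M' M'' descent_degree \<theta>"
proof -
  have "\<theta> ` mV M' \<subseteq> mV M''"
  proof
    fix w assume "w \<in> \<theta> ` mV M'"
    then obtain v' where v': "v' \<in> mV M'" "w = \<theta> v'" by blast
    then have "v' \<in> \<phi> ` points \<Gamma>" using surjective phi.target.points_eq by simp
    then obtain v where v: "v \<in> points \<Gamma>" "v' = \<phi> v" by blast
    then have "v \<in> mV M" using phi.vertex_iff v'(1) by blast
    then show "w \<in> mV M''" using psi.vertex_image factors v v'(2) by metis
  qed
  moreover have "\<theta> ` e' \<in> mE M''" if "e' \<in> mE M'" for e'
    using psi.edge_image[OF lift(1)[OF that]] descent_image[OF lift(1)[OF that]] lift(2)[OF that] by simp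
  moreover have "tc_dist \<Gamma>'' (\<theta> x) (\<theta> y) = ereal (real (descent_degree e')) * tc_dist \<Gamma>' x y"
    if "e' \<in> mE M'" "x \<in> e'" "y \<in> e'" for e' x y
    using descent_dilation[OF lift(1)[OF that(1)], of x y] that lift(2)[OF that(1)]
    unfolding descent_degree_def by simp
  moreover have "0 < descent_degree e'" if "e' \<in> mE M'" for e'
    using psi.edge_degree_pos lift(1)[OF that] unfolding descent_degree_def by blast
  ultimately show ?thesis
    unfolding finite_morphism_wrt_def
    using phi.target.is_model phi.target.loopless psi.target.is_model psi.target.loopless by simp
qed

text \<open>Group the edges at \<open>v\<close> over \<open>e''\<close> by their images in \<open>\<Gamma>'\<close>. All edges in one group have the same
  degree for \<open>\<psi>\<close>, and since \<open>\<phi>\<close> has degree one on edges, the size of the group is the local degree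
  of \<open>\<phi>\<close> at \<open>v\<close>, which is the same for all groups because \<open>\<phi>\<close> is harmonic.\<close>

lemma local_degree_multiplicative:
  assumes v: "v \<in> points \<Gamma>" and e0: "e0 \<in> mE M'" "\<phi> v \<in> e0"
  shows "local_degree M d \<psi> v e'' =
    local_degree M' descent_degree \<theta> (\<phi> v) e'' * local_degree M \<delta> \<phi> v e0"
proof -
  let ?A = "{e \<in> mE M. \<psi> ` e = e'' \<and> v \<in> e}" and ?B = "{e' \<in> mE M'. \<theta> ` e' = e'' \<and> \<phi> v \<in> e'}"
  have fin: "finite ?A" "finite ?B" using phi.source.finite_edges phi.target.finite_edges by auto
  have img: "(\<lambda>e. \<phi> ` e) ` ?A \<subseteq> ?B"
    by (rule image_subsetI) (use phi.edge_image descent_image in blast)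
  have "local_degree M d \<psi> v e'' = (\<Sum>e'\<in>?B. \<Sum>e\<in>{e \<in> ?A. \<phi> ` e = e'}. d e)"
    unfolding local_degree_def by (rule sum.group[OF fin img, symmetric])
  also have "\<dots> = (\<Sum>e'\<in>?B. descent_degree e' * local_degree M \<delta> \<phi> v e0)"
  proof (rule sum.cong[OF refl])
    fix e' assume e': "e' \<in> ?B"
    have "\<psi> ` e = e''" if "e \<in> mE M" "\<phi> ` e = e'" for e
      using descent_image[OF that(1)] that(2) e' by simp
    then have eq: "{e \<in> ?A. \<phi> ` e = e'} = {e \<in> mE M. \<phi> ` e = e' \<and> v \<in> e}" by blast
    have "(\<Sum>e\<in>{e \<in> ?A. \<phi> ` e = e'}. d e) = (\<Sum>e\<in>{e \<in> mE M. \<phi> ` e = e' \<and> v \<in> e}. descent_degree e' * \<delta> e)"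
      unfolding eq by (rule sum.cong[OF refl]) (auto simp: degree_one descent_degree_eq)
    also have "\<dots> = descent_degree e' * local_degree M \<delta> \<phi> v e'"
      unfolding local_degree_def by (simp add: sum_distrib_left)
    also have "local_degree M \<delta> \<phi> v e' = local_degree M \<delta> \<phi> v e0"
      using phi.local_degree_constant[OF phi_harmonic v] e' e0 by blast
    finally show "(\<Sum>e\<in>{e \<in> ?A. \<phi> ` e = e'}. d e) = descent_degree e' * local_degree M \<delta> \<phi> v e0" .
  qed
  also have "\<dots> = local_degree M' descent_degree \<theta> (\<phi> v) e'' * local_degree M \<delta> \<phi> v e0"
    unfolding local_degree_def by (simp add: sum_distrib_right)
  finally show ?thesis .
qed

text \<open>An edge at \<open>v'\<close> lifts to an edge, on which there is a point \<open>v\<close> over \<open>v'\<close>. The local degree of \<open>\<phi>\<close> at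
  such a point is positive, so it cancels from \<open>local_degree_multiplicative\<close>. Without an edge at \<open>v'\<close>
  both sides are empty sums.\<close>

lemma harmonic_descent: "harmonic_wrt M' M'' descent_degree \<theta>"
  unfolding harmonic_wrt_def
proof (intro ballI impI)
  fix v' e'' f''
  assume v': "v' \<in> mV M'" and e'': "e'' \<in> mE M''" "f'' \<in> mE M''"
    and inc: "\<theta> v' \<in># ends (graph M'') e''" "\<theta> v' \<in># ends (graph M'') f''"
  show "local_degree M' descent_degree \<theta> v' e'' = local_degree M' descent_degree \<theta> v' f''"
  proof (cases "\<exists>e0\<in>mE M'. v' \<in> e0")
    case False
    then have none: "{e' \<in> mE M'. \<theta> ` e' = h \<and> v' \<in> e'} = {}" for h by blast
    show ?thesis unfolding local_degree_def by (simp only: none)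
  next
    case True
    then obtain e0 where e0: "e0 \<in> mE M'" "v' \<in> e0" by blast
    then obtain e where e: "e \<in> mE M" "\<phi> ` e = e0" using edges_hit by blast
    then obtain v where v: "v \<in> e" "\<phi> v = v'" using e0(2) by blast
    have vP: "v \<in> points \<Gamma>" using v(1) e(1) phi.source.edge_subset_points by blast
    have "0 < (\<Sum>e\<in>{e \<in> mE M. \<phi> ` e = e0 \<and> v \<in> e}. \<delta> e)"
      using e v(1) degree_one phi.source.finite_edges by (intro sum_pos2[of _ e]) auto
    then have pos: "local_degree M \<delta> \<phi> v e0 \<noteq> 0" unfolding local_degree_def by simp
    have "\<psi> v \<in> e''" "\<psi> v \<in> f''"
      using inc e'' psi.target.incident_iff factors[OF vP] v(2) by auto
    then have "local_degree M d \<psi> v e'' = local_degree M d \<psi> v f''"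
      by (rule psi.local_degree_constant[OF psi_harmonic vP e''])
    then show ?thesis
      using local_degree_multiplicative[OF vP e0(1)] e0(2) v(2) pos by simp
  qed
qed

end


section \<open>The universal property\<close>

theorem theorem1p3:
  fixes G :: "('g, 'z) monoid_scheme"
    and act :: "'g \<Rightarrow> 'a \<Rightarrow> 'a"
    and \<Gamma> :: "'a tcurve" and \<Gamma>' :: "'b tcurve" and \<Gamma>'' :: "'c tcurve"
    and \<phi> :: "'a \<Rightarrow> 'b" and \<psi> :: "'a \<Rightarrow> 'c"
  assumes "group G" and "finite (carrier G)"
    and "tropical_curve \<Gamma>" and "tropical_curve \<Gamma>'" and "tropical_curve \<Gamma>''"
    and "isometric_action G act \<Gamma>"
    and "galois_covering G act \<Gamma> \<Gamma>' \<phi>"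
    and "finite_harmonic_morphism \<Gamma> \<Gamma>'' \<psi>"
    and "\<forall>g\<in>carrier G. \<forall>x\<in>points \<Gamma>. \<psi> (act g x) = \<psi> x"
  shows "\<exists>!\<theta>. \<theta> \<in> extensional (points \<Gamma>') \<and>
           finite_harmonic_morphism \<Gamma>' \<Gamma>'' \<theta> \<and>
           (\<forall>x\<in>points \<Gamma>. \<psi> x = \<theta> (\<phi> x))"
proof -
  obtain M M' \<delta> where phi: "finite_morphism_models \<Gamma> \<Gamma>' M M' \<delta> \<phi>" "harmonic_wrt M M' \<delta> \<phi>"
    and one: "\<forall>e\<in>mE M. \<delta> e = 1" and hit: "\<forall>e'\<in>mE M'. \<exists>e\<in>mE M. \<phi> ` e = e'"
    and surj: "\<phi> ` points \<Gamma> = points \<Gamma>'"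
    using galois_covering_models[OF assms(1,2,7)] .
  obtain L L'' d where psi: "finite_morphism_wrt \<Gamma> \<Gamma>'' L L'' d \<psi>" "harmonic_wrt L L'' d \<psi>"
    and cont: "continuous_map (tc_top \<Gamma>) (tc_top \<Gamma>'') \<psi>"
    using assms(8) unfolding finite_harmonic_morphism_def finite_morphism_def by blast
  interpret phi: finite_morphism_models \<Gamma> \<Gamma>' M M' \<delta> \<phi> by (rule phi(1))
  interpret psi: finite_morphism_models \<Gamma> \<Gamma>'' L L'' d \<psi> by unfold_locales (fact psi(1) cont)+

  have fibers: "\<psi> x = \<psi> y" if xy: "x \<in> points \<Gamma>" "y \<in> points \<Gamma>" "\<phi> x = \<phi> y" for x y
  proof -
    let ?F = "fiber \<Gamma> \<phi> (\<phi> x)"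
    have trans: "transitive_action G ?F (\<lambda>g. restrict (act g) ?F)"
      using assms(7) phi.image_in_points[OF xy(1)] unfolding galois_covering_def by blast
    have "x \<in> ?F" "y \<in> ?F" using xy unfolding fiber_def by auto
    then obtain g where "g \<in> carrier G" "restrict (act g) ?F x = y"
      using transitive_action.unique_orbit[OF trans, of x y] by blast
    then show ?thesis using assms(9) xy(1) \<open>x \<in> ?F\<close> by force
  qed

  \<comment> \<open>The target is subdivided so finely that the preimage \<open>V\<close> of its vertices contains the
     vertices of both given models of \<open>\<Gamma>\<close>.\<close>
  have "\<psi> ` mV M \<subseteq> points \<Gamma>''"
    using psi.image_in_points phi.source.points_eq by blast
  then obtain N'' where N'': "loopless_model \<Gamma>'' N''" "mV N'' = mV L'' \<union> \<psi> ` mV M"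
    using exists_subdivision[OF psi.target.loopless_model_axioms, of "\<psi> ` mV M"]
      phi.source.finite_vertices by blast
  define V where "V = {x \<in> points \<Gamma>. \<psi> x \<in> mV N''}"
  have V: "finite V" "V \<subseteq> points \<Gamma>"
    unfolding V_def using psi.finite_preimage loopless_model.finite_vertices[OF N''(1)] by auto
  have "mV L \<subseteq> V"
    unfolding V_def N''(2) using psi.vertex_image psi.source.points_eq by auto
  then obtain N where N: "loopless_model \<Gamma> N" "mV N = V"
    using exists_subdivision[OF psi.source.loopless_model_axioms V] by (metis sup.absorb2)
  have V': "mV M' \<subseteq> \<phi> ` V"
  proof
    fix v' assume v': "v' \<in> mV M'"
    then have "v' \<in> \<phi> ` points \<Gamma>" using surj phi.target.points_eq by simp
    then obtain v where v: "v \<in> points \<Gamma>" "v' = \<phi> v" by blast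
    then have "v \<in> mV M" using phi.vertex_iff v' by blast
    then show "v' \<in> \<phi> ` V" unfolding V_def N''(2) using v by blast
  qed
  have "\<phi> ` V \<subseteq> points \<Gamma>'" using V(2) phi.image_in_points by blast
  then obtain N' where N': "loopless_model \<Gamma>' N'" "mV N' = mV M' \<union> \<phi> ` V"
    using exists_subdivision[OF phi.target.loopless_model_axioms finite_imageI[OF V(1)]] by blast
  \<comment> \<open>As \<open>\<psi>\<close> is constant on the fibers of \<open>\<phi>\<close>, the set \<open>V\<close> is a union of such fibers. So the same
     model \<open>N\<close> serves both morphisms.\<close>
  have saturated: "mV N = {x \<in> points \<Gamma>. \<phi> x \<in> mV N'}"
  proof (intro equalityI subsetI)
    fix x assume "x \<in> {x \<in> points \<Gamma>. \<phi> x \<in> mV N'}"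
    then have x: "x \<in> points \<Gamma>" "\<phi> x \<in> \<phi> ` V" using N'(2) V' by auto
    then obtain y where y: "y \<in> V" "\<phi> x = \<phi> y" by blast
    then have "\<psi> x = \<psi> y" using fibers[OF x(1)] V(2) by blast
    then show "x \<in> mV N" using x(1) y(1) N(2) unfolding V_def by simp
  qed (use N(2) N'(2) V(2) in auto)

  have "mV M' \<subseteq> mV N'" "mV L'' \<subseteq> mV N''" "mV N = {x \<in> points \<Gamma>. \<psi> x \<in> mV N''}"
    using N'(2) N''(2) N(2) V_def by simp_all
  note vertices = this
  interpret phi': subdivided_morphism \<Gamma> \<Gamma>' M M' \<delta> \<phi> N N'
    by (intro subdivided_morphism.intro subdivided_morphism_axioms.intro)
       (fact phi(1) N(1) N'(1) vertices saturated)+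
  interpret psi': subdivided_morphism \<Gamma> \<Gamma>'' L L'' d \<psi> N N''
    by (intro subdivided_morphism.intro subdivided_morphism_axioms.intro)
       (fact psi.finite_morphism_models_axioms N(1) N''(1) vertices)+

  have hit': "\<exists>e\<in>mE N. \<phi> ` e = e'" if e': "e' \<in> mE N'" for e'
  proof -
    obtain f' where "f' \<in> mE M'" "e' \<subseteq> f'"
      using edge_of_refinement[OF phi.target.loopless_model_axioms N'(1) phi'.vertices' e'] .
    then show ?thesis using hit phi'.refined_edge_over[OF _ e'] by metis
  qed

  define \<theta> where "\<theta> = restrict (\<lambda>y. \<psi> (SOME x. x \<in> points \<Gamma> \<and> \<phi> x = y)) (points \<Gamma>')"
  have factors: "\<psi> x = \<theta> (\<phi> x)" if x: "x \<in> points \<Gamma>" for x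
  proof -
    have "(SOME z. z \<in> points \<Gamma> \<and> \<phi> z = \<phi> x) \<in> points \<Gamma> \<and> \<phi> (SOME z. z \<in> points \<Gamma> \<and> \<phi> z = \<phi> x) = \<phi> x"
      using x by (rule_tac someI_ex) blast
    then show ?thesis
      unfolding \<theta>_def using fibers[OF x] phi.image_in_points[OF x] by simp
  qed
  interpret descent \<Gamma> \<Gamma>' \<Gamma>'' N N' N'' phi'.refined_degree psi'.refined_degree \<phi> \<psi> \<theta>
  proof (intro descent.intro descent_axioms.intro)
    show "finite_morphism_models \<Gamma> \<Gamma>' N N' phi'.refined_degree \<phi>" by (rule phi'.refined)
    show "finite_morphism_models \<Gamma> \<Gamma>'' N N'' psi'.refined_degree \<psi>" by (rule psi'.refined)
    show "harmonic_wrt N N' phi'.refined_degree \<phi>" by (rule phi'.harmonic_refined[OF phi(2)])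
    show "harmonic_wrt N N'' psi'.refined_degree \<psi>" by (rule psi'.harmonic_refined[OF psi(2)])
    show "phi'.refined_degree e = 1" if "e \<in> mE N" for e
      using one phi'.enclosing(1)[OF that] unfolding phi'.refined_degree_def by blast
  qed (use hit' surj factors in auto)

  show ?thesis
  proof (rule ex1I[of _ \<theta>], intro conjI ballI)
    show "\<theta> \<in> extensional (points \<Gamma>')" unfolding \<theta>_def by simp
    show "finite_harmonic_morphism \<Gamma>' \<Gamma>'' \<theta>"
      unfolding finite_harmonic_morphism_def finite_morphism_def
      using assms(4,5) continuous_descent finite_morphism_descent harmonic_descent by blast
    show "\<And>x. x \<in> points \<Gamma> \<Longrightarrow> \<psi> x = \<theta> (\<phi> x)" by (rule factors)
  next
    fix \<eta> assume \<eta>: "\<eta> \<in> extensional (points \<Gamma>') \<and> finite_harmonic_morphism \<Gamma>' \<Gamma>'' \<eta> \<and>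
           (\<forall>x\<in>points \<Gamma>. \<psi> x = \<eta> (\<phi> x))"
    show "\<eta> = \<theta>"
    proof (rule extensionalityI[of _ "points \<Gamma>'"])
      show "\<eta> \<in> extensional (points \<Gamma>')" "\<theta> \<in> extensional (points \<Gamma>')"
        using \<eta> unfolding \<theta>_def by simp_all
      fix y assume "y \<in> points \<Gamma>'"
      then have "y \<in> \<phi> ` points \<Gamma>" using surj by simp
      then obtain x where "x \<in> points \<Gamma>" "y = \<phi> x" by blast
      then show "\<eta> y = \<theta> y" using \<eta> factors by metis
    qed
  qed
qed

end
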